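(* Let $\mathbf{C}$ be a snowflake with $M$ edges. If $M\equiv 0,3 \pmod 4$ then $\mathbf{C}$ is conservative; otherwise (i.e. $M\equiv 1,2\pmod 4$) $\mathbf{C}$ is near-conservative.
   Context: A snowflake is the tree obtained from a disjoint union of stars $S_1,\ldots,S_p$ ($S_i\cong K_{1,n_i}$, $n_i\geq 3$) by identifying one leaf of each star into a single vertex $z$, called the center. A labeling of a graph $G$ is a bijection from $E(G)$ to a set of $|E(G)|$ positive integers. Given an orientation $\overrightarrow{G}$ of $G$ and a labeling $\phi$, the vertex-sum of $u$ is $s(u)=\sum_{\overrightarrow{vu}}\phi(uv)-\sum_{\overrightarrow{uv}}\phi(uv)$ (labels of incoming arcs minus labels of outgoing arcs). For $G$ with $M$ edges, a conservative labeling is a pair (orientation, labeling) with label set $[1,M]$ such that $s(u)=0$ at every vertex $u$ of degree at least $3$; a near-conservative labeling is the same with label set $[1,M-1]\cup\{M+1\}$. Here $[a,b]$ denotes $\{a,a+1,\ldots,b\}$. $G$ is conservative if it admits a conservative labeling, and near-conservative if it is not conservative but admits a near-conservative labeling. *)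

theory Defs
  imports Main
begin

text \<open>A simple graph is given by its vertex set \<open>V\<close> and its set \<open>E\<close> of two-element edges.\<close>

definition degree :: "'a set set \<Rightarrow> 'a \<Rightarrow> nat" where
  "degree E u = card {e \<in> E. u \<in> e}"

definition graph_iso :: "'a set \<Rightarrow> 'a set set \<Rightarrow> 'b set \<Rightarrow> 'b set set \<Rightarrow> bool" where
  "graph_iso V E V' E' \<longleftrightarrow>
     (\<exists>f. bij_betw f V V' \<and> (\<forall>u\<in>V. \<forall>v\<in>V. {u, v} \<in> E \<longleftrightarrow> {f u, f v} \<in> E'))"

text \<open>
  The disjoint union of the stars \<open>K\<^bsub>1,n i\<^esub>\<close> for \<open>i < p\<close>: the pair \<open>(i, 0)\<close> is the
  centre of the \<open>i\<close>-th star and \<open>(i, 1), \<dots>, (i, n i)\<close> are its leaves.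
\<close>

definition stars_verts :: "nat \<Rightarrow> (nat \<Rightarrow> nat) \<Rightarrow> (nat \<times> nat) set" where
  "stars_verts p n = {(i, j). i < p \<and> j \<le> n i}"

definition stars_edges :: "nat \<Rightarrow> (nat \<Rightarrow> nat) \<Rightarrow> (nat \<times> nat) set set" where
  "stars_edges p n = {{(i, 0), (i, j)} | i j. i < p \<and> 1 \<le> j \<and> j \<le> n i}"

text \<open>
  The leaf \<open>(i, 1)\<close> of every star is identified with \<open>(0, 1)\<close>, which becomes the centre
  \<open>z\<close> of the snowflake.
\<close>

definition glue :: "nat \<times> nat \<Rightarrow> nat \<times> nat" where
  "glue x = (if snd x = 1 then (0, 1) else x)"

definition snowflake :: "'a set \<Rightarrow> 'a set set \<Rightarrow> bool" where
  "snowflake V E \<longleftrightarrow> E \<subseteq> {e. e \<subseteq> V \<and> card e = 2} \<and>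
     (\<exists>p n. 1 \<le> p \<and> (\<forall>i<p. 3 \<le> n i) \<and>
        graph_iso V E (glue ` stars_verts p n) ((`) glue ` stars_edges p n))"

text \<open>An orientation is a set of arcs, \<open>(u, v)\<close> being directed from \<open>u\<close> to \<open>v\<close>.\<close>

definition orientation :: "'a set set \<Rightarrow> ('a \<times> 'a) set \<Rightarrow> bool" where
  "orientation E A \<longleftrightarrow> bij_betw (\<lambda>(u, v). {u, v}) A E"

definition vertex_sum :: "('a \<times> 'a) set \<Rightarrow> ('a set \<Rightarrow> nat) \<Rightarrow> 'a \<Rightarrow> int" where
  "vertex_sum A \<phi> u =
     (\<Sum>v | (v, u) \<in> A. int (\<phi> {u, v})) - (\<Sum>v | (u, v) \<in> A. int (\<phi> {u, v}))"

definition balanced_labeling ::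
    "'a set \<Rightarrow> 'a set set \<Rightarrow> nat set \<Rightarrow> ('a \<times> 'a) set \<Rightarrow> ('a set \<Rightarrow> nat) \<Rightarrow> bool" where
  "balanced_labeling V E L A \<phi> \<longleftrightarrow>
     orientation E A \<and> bij_betw \<phi> E L \<and> (\<forall>u\<in>V. 3 \<le> degree E u \<longrightarrow> vertex_sum A \<phi> u = 0)"

definition conservative_labeling ::
    "'a set \<Rightarrow> 'a set set \<Rightarrow> ('a \<times> 'a) set \<Rightarrow> ('a set \<Rightarrow> nat) \<Rightarrow> bool" where
  "conservative_labeling V E A \<phi> \<longleftrightarrow> balanced_labeling V E {1..card E} A \<phi>"

definition near_conservative_labeling ::
    "'a set \<Rightarrow> 'a set set \<Rightarrow> ('a \<times> 'a) set \<Rightarrow> ('a set \<Rightarrow> nat) \<Rightarrow> bool" where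
  "near_conservative_labeling V E A \<phi> \<longleftrightarrow>
     balanced_labeling V E ({1..card E - 1} \<union> {card E + 1}) A \<phi>"

definition conservative :: "'a set \<Rightarrow> 'a set set \<Rightarrow> bool" where
  "conservative V E \<longleftrightarrow> (\<exists>A \<phi>. conservative_labeling V E A \<phi>)"

definition near_conservative :: "'a set \<Rightarrow> 'a set set \<Rightarrow> bool" where
  "near_conservative V E \<longleftrightarrow>
     \<not> conservative V E \<and> (\<exists>A \<phi>. near_conservative_labeling V E A \<phi>)"

end

theory Submission
  imports Defs
begin

text \<open>
  Every star centre has zero sum, so the labels of each star add up to an even number; as the stars
  partition the edges, a conservative labeling forces \<open>1 + \<dots> + M\<close> to be even, i.e.
  \<open>M \<equiv> 0, 3 (mod 4)\<close>.

  For existence, a star of size \<open>n\<close> becomes a list of \<open>n\<close> signed labels with sum zero, and since the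
  numbers of labels and edges agree it suffices that the lists cover the label set. Four (nearly)
  consecutive labels at the top can be signed to sum zero, so sizes matter only modulo 4 and reduce to
  3, 4, 5, 6. Stars of size 4 and 6 are (nearly) consecutive blocks at the top. For the \<open>t\<close> stars of
  size 3 and 5, a Skolem or hooked Skolem sequence pairs positions at distances \<open>1, \<dots>, t\<close>, which gives
  triples \<open>d, a, a + d\<close>; two 5-stars with consecutive \<open>d\<close> exchange their pairs and compensate by
  adjacent labels, and a leftover 5-star uses \<open>1 + 1 = 2\<close>.

  For the centre of the snowflake one label of each star has to be selected so that the selection
  can be signed to sum zero (reversing a whole star is free). The differences \<open>1, \<dots>, t\<close> and pairs of
  neighbouring labels from two blocks do this up to a parity defect, which is repaired by
  selecting a different label in one star.
\<close>

section \<open>Skolem sequences\<close>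

text \<open>Serves twice: as the positions of a Skolem or hooked Skolem sequence, and as the label
  set of a conservative or near-conservative labeling.\<close>

definition gap_interval :: "bool \<Rightarrow> int \<Rightarrow> int set" where
  "gap_interval h N = (if h then {1..N - 1} \<union> {N + 1} else {1..N})"

text \<open>
  \<open>a d\<close> is the left end of the pair of positions at distance \<open>d\<close>. Only covering is required, as
  counting forces the pairs to be disjoint. The last two conditions locate the pair containing the
  last position, and bound the pair at distance 1.
\<close>

definition skolem :: "int \<Rightarrow> (int \<Rightarrow> int) \<Rightarrow> bool" where
  "skolem t a \<longleftrightarrow>
     (\<forall>u\<in>gap_interval (t mod 4 \<in> {2, 3}) (2 * t). \<exists>d\<in>{1..t}. u = a d \<or> u = a d + d) \<and>
     (\<exists>e\<in>{max 1 (t - 1)..t}. a e + e = (if t mod 4 \<in> {2, 3} then 2 * t + 1 else 2 * t)) \<and>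
     (t mod 4 \<in> {1, 2} \<and> 5 \<le> t \<longrightarrow> 0 \<le> a 1 \<and> 2 * (t + a 1 + 1) \<le> t * (t + 1) - 8)"

text \<open>These orders lie below the range of the general constructions.\<close>

lemma skolem_small:
  "skolem 1 (\<lambda>d. 1)"
  "skolem 2 (\<lambda>d. if d = 1 then 1 else 3)"
  "skolem 3 (\<lambda>d. if d = 1 then 1 else d + 1)"
  "skolem 4 (\<lambda>d. if d = 2 then 5 else d)"
  "skolem 5 (\<lambda>d. if d = 2 then 7 else d)"
proof -
  have 1: "{1..2::int} = {1,2}" "{1..3::int} = {1,2,3}" "{1..4::int} = {1,2,3,4}"
     "{1..5::int} = {1,2,3,4,5}" "{1..8::int} = {1,2,3,4,5,6,7,8}"
     "{1..10::int} = {1,2,3,4,5,6,7,8,9,10}" "{1..1::int} = {1}"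
    "{2..3::int} = {2,3}"  "{3..4::int} = {3,4}" "{4..5::int} = {4,5}"
    by (simp_all add: set_eq_iff) presburger+
  show
  "skolem 1 (\<lambda>d. 1)"
  "skolem 2 (\<lambda>d. if d = 1 then 1 else 3)"
  "skolem 3 (\<lambda>d. if d = 1 then 1 else d + 1)"
  "skolem 4 (\<lambda>d. if d = 2 then 5 else d)"
  "skolem 5 (\<lambda>d. if d = 2 then 7 else d)"
    by (simp_all add: skolem_def gap_interval_def 1)
qed

text \<open>The pairs of even distance are nested around the hole \<open>6 * s\<close>. The odd
  distances between \<open>1\<close> and \<open>2 * s - 1\<close>, and those between
  \<open>2 * s + 1\<close> and \<open>4 * s - 1\<close>, form two further nests lower down. The four
  odd distances left over fill the remaining holes; in particular \<open>4 * s - 1\<close> joins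
  \<open>2 * s + 1\<close> to \<open>6 * s\<close>.\<close>

lemma skolem_exists_mod_0:
  assumes s: "2 \<le> (s::int)"
  shows "\<exists>a. skolem (4 * s) a"
proof -
  define a where "a d = (if even d then 6 * s - d div 2
    else if d = 4 * s - 1 then 2 * s + 1
    else if 2 * s + 3 \<le> d then 2 * s - 1 - d div 2
    else if d = 2 * s + 1 then s - 1
    else if d = 2 * s - 1 then 2 * s
    else if d = 1 then s else 2 * s - d div 2)" for d :: int
  have aE: "a (2 * h) = 6 * s - h" for h by (simp add: a_def)
  have aO1: "a (2 * h + 1) = 2 * s - 1 - h" if "s + 1 \<le> h" "h \<le> 2 * s - 2" for h
    using that by (auto simp: a_def)
  have aO2: "a (2 * h + 1) = 2 * s - h" if "1 \<le> h" "h \<le> s - 2" for h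
    using that by (auto simp: a_def)
  have aX: "a (4 * s - 1) = 2 * s + 1" "a (2 * s + 1) = s - 1" "a (2 * s - 1) = 2 * s" "a 1 = s"
    using s by (auto simp: a_def)
  have cov: "\<exists>d\<in>{1..4 * s}. u = a d \<or> u = a d + d" if u: "u \<in> gap_interval False (8 * s)" for u
  proof -
    \<comment> \<open>Consecutive disjuncts are the two ends of one nest or of one exceptional
      pair.\<close>
    have "(4*s \<le> u \<and> u \<le> 6*s-1)
      \<or> (6*s+1 \<le> u \<and> u \<le> 8*s)
      \<or> u = 6*s
      \<or> u = 2*s+1
      \<or> (1 \<le> u \<and> u \<le> s-2)
      \<or> (3*s+1 \<le> u \<and> u \<le> 4*s-2)
      \<or> u = s-1
      \<or> u = 3*s
      \<or> u = s
      \<or> u = s+1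
      \<or> u = 2*s
      \<or> u = 4*s-1
      \<or> (s+2 \<le> u \<and> u \<le> 2*s-1)
      \<or> (2*s+2 \<le> u \<and> u \<le> 3*s-1)"
      using u s unfolding gap_interval_def if_True if_False Un_iff atLeastAtMost_iff singleton_iff
      by (smt (verit))
    then show ?thesis
    proof (elim disjE)
      assume "(4*s \<le> u \<and> u \<le> 6*s-1)"
      with s aE[of "6*s-u"] show ?thesis by (intro bexI[of _ "2 * (6*s-u)"]) auto
    next
      assume "(6*s+1 \<le> u \<and> u \<le> 8*s)"
      with s aE[of "u-6*s"] show ?thesis by (intro bexI[of _ "2 * (u-6*s)"]) auto
    next
      assume "u = 6*s"
      with s aX show ?thesis by (intro bexI[of _ "4*s-1"]) auto
    next
      assume "u = 2*s+1"
      with s aX show ?thesis by (intro bexI[of _ "4*s-1"]) auto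
    next
      assume "(1 \<le> u \<and> u \<le> s-2)"
      with s aO1[of "2*s-1-u"] show ?thesis by (intro bexI[of _ "2 * (2*s-1-u) + 1"]) auto
    next
      assume "(3*s+1 \<le> u \<and> u \<le> 4*s-2)"
      with s aO1[of "u-2*s"] show ?thesis by (intro bexI[of _ "2 * (u-2*s) + 1"]) auto
    next
      assume "u = s-1"
      with s aX show ?thesis by (intro bexI[of _ "2*s+1"]) auto
    next
      assume "u = 3*s"
      with s aX show ?thesis by (intro bexI[of _ "2*s+1"]) auto
    next
      assume "u = s"
      with s aX show ?thesis by (intro bexI[of _ "1"]) auto
    next
      assume "u = s+1"
      with s aX show ?thesis by (intro bexI[of _ "1"]) auto
    next
      assume "u = 2*s"
      with s aX show ?thesis by (intro bexI[of _ "2*s-1"]) auto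
    next
      assume "u = 4*s-1"
      with s aX show ?thesis by (intro bexI[of _ "2*s-1"]) auto
    next
      assume "(s+2 \<le> u \<and> u \<le> 2*s-1)"
      with s aO2[of "2*s-u"] show ?thesis by (intro bexI[of _ "2 * (2*s-u) + 1"]) auto
    next
      assume "(2*s+2 \<le> u \<and> u \<le> 3*s-1)"
      with s aO2[of "u-2*s-1"] show ?thesis by (intro bexI[of _ "2 * (u-2*s-1) + 1"]) auto
    qed
  qed
  have "skolem (4 * s) a"
    using cov s aE[of "2 * s"] by (auto simp: skolem_def intro!: bexI[of _ "4 * s"])
  then  show ?thesis by blast
qed

text \<open>The even distances are nested around \<open>6 * s + 2\<close>, and distance
  \<open>4 * s + 1\<close> fills that hole. The odd distances from \<open>2 * s + 1\<close> to
  \<open>4 * s - 1\<close> and those from \<open>3\<close> to \<open>2 * s - 3\<close> are nested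
  lower down; distances \<open>2 * s - 1\<close> and \<open>1\<close> take what remains. The last
  position belongs to distance \<open>4 * s\<close>, one less than the order.\<close>

lemma skolem_exists_mod_1:
  assumes s: "2 \<le> (s::int)"
  shows "\<exists>a. skolem (4 * s + 1) a"
proof -
  define a where "a d = (if even d then 6 * s + 2 - d div 2
    else if d = 4 * s + 1 then 2 * s + 1
    else if 2 * s + 1 \<le> d then 2 * s - d div 2
    else if d = 2 * s - 1 then 2 * s + 2
    else if d = 1 then s + 1 else 2 * s + 1 - d div 2)" for d :: int
  have aE: "a (2 * h) = 6 * s + 2 - h" for h by (simp add: a_def)
  have aO1: "a (2 * h + 1) = 2 * s - h" if "s \<le> h" "h \<le> 2 * s - 1" for h
    using that by (auto simp: a_def)
  have aO2: "a (2 * h + 1) = 2 * s + 1 - h" if "1 \<le> h" "h \<le> s - 2" for h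
    using that by (auto simp: a_def)
  have aX: "a (4 * s + 1) = 2 * s + 1" "a (2 * s - 1) = 2 * s + 2" "a 1 = s + 1"
    using s by (auto simp: a_def)
  have cov: "\<exists>d\<in>{1..4 * s + 1}. u = a d \<or> u = a d + d" if u: "u \<in> gap_interval False (8 * s + 2)" for u
  proof -
    have "(4*s+2 \<le> u \<and> u \<le> 6*s+1)
      \<or> (6*s+3 \<le> u \<and> u \<le> 8*s+2)
      \<or> u = 6*s+2
      \<or> u = 2*s+1
      \<or> (1 \<le> u \<and> u \<le> s)
      \<or> (3*s+1 \<le> u \<and> u \<le> 4*s)
      \<or> u = s+1
      \<or> u = s+2
      \<or> u = 2*s+2
      \<or> u = 4*s+1
      \<or> (s+3 \<le> u \<and> u \<le> 2*s)
      \<or> (2*s+3 \<le> u \<and> u \<le> 3*s)"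
      using u s unfolding gap_interval_def if_True if_False Un_iff atLeastAtMost_iff singleton_iff
      by (smt (verit))
    then show ?thesis
    proof (elim disjE)
      assume "(4*s+2 \<le> u \<and> u \<le> 6*s+1)"
      with s aE[of "6*s+2-u"] show ?thesis by (intro bexI[of _ "2 * (6*s+2-u)"]) auto
    next
      assume "(6*s+3 \<le> u \<and> u \<le> 8*s+2)"
      with s aE[of "u-6*s-2"] show ?thesis by (intro bexI[of _ "2 * (u-6*s-2)"]) auto
    next
      assume "u = 6*s+2"
      with s aX show ?thesis by (intro bexI[of _ "4*s+1"]) auto
    next
      assume "u = 2*s+1"
      with s aX show ?thesis by (intro bexI[of _ "4*s+1"]) auto
    next
      assume "(1 \<le> u \<and> u \<le> s)"
      with s aO1[of "2*s-u"] show ?thesis by (intro bexI[of _ "2 * (2*s-u) + 1"]) auto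
    next
      assume "(3*s+1 \<le> u \<and> u \<le> 4*s)"
      with s aO1[of "u-2*s-1"] show ?thesis by (intro bexI[of _ "2 * (u-2*s-1) + 1"]) auto
    next
      assume "u = s+1"
      with s aX show ?thesis by (intro bexI[of _ "1"]) auto
    next
      assume "u = s+2"
      with s aX show ?thesis by (intro bexI[of _ "1"]) auto
    next
      assume "u = 2*s+2"
      with s aX show ?thesis by (intro bexI[of _ "2*s-1"]) auto
    next
      assume "u = 4*s+1"
      with s aX show ?thesis by (intro bexI[of _ "2*s-1"]) auto
    next
      assume "(s+3 \<le> u \<and> u \<le> 2*s)"
      with s aO2[of "2*s+1-u"] show ?thesis by (intro bexI[of _ "2 * (2*s+1-u) + 1"]) auto
    next
      assume "(2*s+3 \<le> u \<and> u \<le> 3*s)"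
      with s aO2[of "u-2*s-2"] show ?thesis by (intro bexI[of _ "2 * (u-2*s-2) + 1"]) auto
    qed
  qed
  \<comment> \<open>Naming the square turns the quadratic bound on \<open>a 1\<close> into a linear
    one in \<open>k\<close> and \<open>s\<close>.\<close>
  obtain k where k: "k = s * s" by blast
  have k2: "2 * 2 \<le> k" unfolding k using s by (intro mult_mono) auto
  have eq: "(4 * s + 1) * (4 * s + 1 + 1) = 16 * k + 12 * s + 2"
    by (simp add: k algebra_simps)
  have "2 * (4 * s + 1 + a 1 + 1) \<le> (4 * s + 1) * (4 * s + 1 + 1) - 8"
    using s k2 unfolding aX eq by simp
  moreover have "(4 * s + 1) mod 4 = 1" by presburger
  ultimately have "skolem (4 * s + 1) a"
    using cov s aE[of "2 * s"] aX(3) by (auto simp: skolem_def intro!: bexI[of _ "4 * s"])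
  then  show ?thesis by blast
qed

text \<open>Here the even nest lies at the bottom, around \<open>2 * s + 1\<close>, and the odd
  nests lie above it. Distance \<open>4 * s + 1\<close> starts in the hole of the even nest, and
  distance \<open>4 * s + 2\<close> ends at the hook \<open>8 * s + 5\<close>.\<close>

lemma skolem_exists_mod_2:
  assumes s: "1 \<le> (s::int)"
  shows "\<exists>a. skolem (4 * s + 2) a"
proof -
  define a where "a d = (if d = 4 * s + 2 then 4 * s + 3
    else if even d then 2 * s + 1 - d div 2
    else if d = 4 * s + 1 then 2 * s + 1
    else if 2 * s + 3 \<le> d then 6 * s + 3 - d div 2
    else if d = 2 * s + 1 then 4 * s + 2
    else if d = 1 then 7 * s + 3 else 6 * s + 2 - d div 2)" for d :: int
  have aE: "a (2 * h) = 2 * s + 1 - h" if "h \<le> 2 * s" for h using that by (auto simp: a_def)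
  have aO1: "a (2 * h + 1) = 6 * s + 3 - h" if "s + 1 \<le> h" "h \<le> 2 * s - 1" for h
    using that by (auto simp: a_def)
  have aO2: "a (2 * h + 1) = 6 * s + 2 - h" if "1 \<le> h" "h \<le> s - 1" for h
    using that by (auto simp: a_def)
  have aX: "a (4 * s + 2) = 4 * s + 3" "a (4 * s + 1) = 2 * s + 1" "a (2 * s + 1) = 4 * s + 2" "a 1 = 7 * s + 3"
    using s by (auto simp: a_def)
  have cov: "\<exists>d\<in>{1..4 * s + 2}. u = a d \<or> u = a d + d" if u: "u \<in> gap_interval True (8 * s + 4)" for u
  proof -
    have "(1 \<le> u \<and> u \<le> 2*s)
      \<or> (2*s+2 \<le> u \<and> u \<le> 4*s+1)
      \<or> u = 6*s+2
      \<or> u = 2*s+1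
      \<or> (4*s+4 \<le> u \<and> u \<le> 5*s+2)
      \<or> (7*s+5 \<le> u \<and> u \<le> 8*s+3)
      \<or> u = 4*s+2
      \<or> u = 6*s+3
      \<or> u = 7*s+3
      \<or> u = 7*s+4
      \<or> u = 4*s+3
      \<or> u = 8*s+5
      \<or> (5*s+3 \<le> u \<and> u \<le> 6*s+1)
      \<or> (6*s+4 \<le> u \<and> u \<le> 7*s+2)"
      using u s unfolding gap_interval_def if_True if_False Un_iff atLeastAtMost_iff singleton_iff
      by (smt (verit))
    then show ?thesis
    proof (elim disjE)
      assume "(1 \<le> u \<and> u \<le> 2*s)"
      with s aE[of "2*s+1-u"] show ?thesis by (intro bexI[of _ "2 * (2*s+1-u)"]) auto
    next
      assume "(2*s+2 \<le> u \<and> u \<le> 4*s+1)"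
      with s aE[of "u-2*s-1"] show ?thesis by (intro bexI[of _ "2 * (u-2*s-1)"]) auto
    next
      assume "u = 6*s+2"
      with s aX show ?thesis by (intro bexI[of _ "4*s+1"]) auto
    next
      assume "u = 2*s+1"
      with s aX show ?thesis by (intro bexI[of _ "4*s+1"]) auto
    next
      assume "(4*s+4 \<le> u \<and> u \<le> 5*s+2)"
      with s aO1[of "6*s+3-u"] show ?thesis by (intro bexI[of _ "2 * (6*s+3-u) + 1"]) auto
    next
      assume "(7*s+5 \<le> u \<and> u \<le> 8*s+3)"
      with s aO1[of "u-6*s-4"] show ?thesis by (intro bexI[of _ "2 * (u-6*s-4) + 1"]) auto
    next
      assume "u = 4*s+2"
      with s aX show ?thesis by (intro bexI[of _ "2*s+1"]) auto
    next
      assume "u = 6*s+3"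
      with s aX show ?thesis by (intro bexI[of _ "2*s+1"]) auto
    next
      assume "u = 7*s+3"
      with s aX show ?thesis by (intro bexI[of _ "1"]) auto
    next
      assume "u = 7*s+4"
      with s aX show ?thesis by (intro bexI[of _ "1"]) auto
    next
      assume "u = 4*s+3"
      with s aX show ?thesis by (intro bexI[of _ "4*s+2"]) auto
    next
      assume "u = 8*s+5"
      with s aX show ?thesis by (intro bexI[of _ "4*s+2"]) auto
    next
      assume "(5*s+3 \<le> u \<and> u \<le> 6*s+1)"
      with s aO2[of "6*s+2-u"] show ?thesis by (intro bexI[of _ "2 * (6*s+2-u) + 1"]) auto
    next
      assume "(6*s+4 \<le> u \<and> u \<le> 7*s+2)"
      with s aO2[of "u-6*s-3"] show ?thesis by (intro bexI[of _ "2 * (u-6*s-3) + 1"]) auto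
    qed
  qed
  obtain k where k: "k = s * s" by blast
  have k2: "s * 1 \<le> k" unfolding k using s by (intro mult_mono) auto
  have eq: "(4 * s + 2) * (4 * s + 2 + 1) = 16 * k + 20 * s + 6"
    by (simp add: k algebra_simps)
  have "2 * (4 * s + 2 + a 1 + 1) \<le> (4 * s + 2) * (4 * s + 2 + 1) - 8"
    using s k2 unfolding aX eq by simp
  moreover have "(4 * s + 2) mod 4 = 2" by presburger
  ultimately have "skolem (4 * s + 2) a"
    using cov s aX by (auto simp: skolem_def intro!: bexI[of _ "4 * s + 2"])
  then  show ?thesis by blast
qed

text \<open>The pairs of odd distance below \<open>4 * s - 1\<close> are those of
  \<open>skolem_exists_mod_0\<close>. The two largest distances are exceptional:
  \<open>4 * s - 2\<close> fills the hole \<open>6 * s - 1\<close> of the even nest, and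
  \<open>4 * s - 1\<close> ends at the hook \<open>8 * s - 1\<close>.\<close>

lemma skolem_exists_mod_3:
  assumes s: "2 \<le> (s::int)"
  shows "\<exists>a. skolem (4 * s - 1) a"
proof -
  define a where "a d = (if d = 4 * s - 2 then 2 * s + 1
    else if even d then 6 * s - 1 - d div 2
    else if d = 4 * s - 1 then 4 * s
    else if 2 * s + 3 \<le> d then 2 * s - 1 - d div 2
    else if d = 2 * s + 1 then s - 1
    else if d = 2 * s - 1 then 2 * s
    else if d = 1 then s else 2 * s - d div 2)" for d :: int
  have aE: "a (2 * h) = 6 * s - 1 - h" if "h \<le> 2 * s - 2" for h using that by (auto simp: a_def)
  have aO1: "a (2 * h + 1) = 2 * s - 1 - h" if "s + 1 \<le> h" "h \<le> 2 * s - 2" for h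
    using that by (auto simp: a_def)
  have aO2: "a (2 * h + 1) = 2 * s - h" if "1 \<le> h" "h \<le> s - 2" for h
    using that by (auto simp: a_def)
  have aX: "a (4 * s - 2) = 2 * s + 1" "a (4 * s - 1) = 4 * s" "a (2 * s + 1) = s - 1"
    "a (2 * s - 1) = 2 * s" "a 1 = s"
    using s by (auto simp: a_def)
  have cov: "\<exists>d\<in>{1..4 * s - 1}. u = a d \<or> u = a d + d" if u: "u \<in> gap_interval True (8 * s - 2)" for u
  proof -
    have "(4*s+1 \<le> u \<and> u \<le> 6*s-2)
      \<or> (6*s \<le> u \<and> u \<le> 8*s-3)
      \<or> u = 6*s-1
      \<or> u = 2*s+1
      \<or> u = 4*s
      \<or> u = 8*s-1
      \<or> (1 \<le> u \<and> u \<le> s-2)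
      \<or> (3*s+1 \<le> u \<and> u \<le> 4*s-2)
      \<or> u = s-1
      \<or> u = 3*s
      \<or> u = s
      \<or> u = s+1
      \<or> u = 2*s
      \<or> u = 4*s-1
      \<or> (s+2 \<le> u \<and> u \<le> 2*s-1)
      \<or> (2*s+2 \<le> u \<and> u \<le> 3*s-1)"
      using u s unfolding gap_interval_def if_True if_False Un_iff atLeastAtMost_iff singleton_iff
      by (smt (verit))
    then show ?thesis
    proof (elim disjE)
      assume "(4*s+1 \<le> u \<and> u \<le> 6*s-2)"
      with s aE[of "6*s-1-u"] show ?thesis by (intro bexI[of _ "2 * (6*s-1-u)"]) auto
    next
      assume "(6*s \<le> u \<and> u \<le> 8*s-3)"
      with s aE[of "u-6*s+1"] show ?thesis by (intro bexI[of _ "2 * (u-6*s+1)"]) auto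
    next
      assume "u = 6*s-1"
      with s aX show ?thesis by (intro bexI[of _ "4*s-2"]) auto
    next
      assume "u = 2*s+1"
      with s aX show ?thesis by (intro bexI[of _ "4*s-2"]) auto
    next
      assume "u = 4*s"
      with s aX show ?thesis by (intro bexI[of _ "4*s-1"]) auto
    next
      assume "u = 8*s-1"
      with s aX show ?thesis by (intro bexI[of _ "4*s-1"]) auto
    next
      assume "(1 \<le> u \<and> u \<le> s-2)"
      with s aO1[of "2*s-1-u"] show ?thesis by (intro bexI[of _ "2 * (2*s-1-u) + 1"]) auto
    next
      assume "(3*s+1 \<le> u \<and> u \<le> 4*s-2)"
      with s aO1[of "u-2*s"] show ?thesis by (intro bexI[of _ "2 * (u-2*s) + 1"]) auto
    next
      assume "u = s-1"
      with s aX show ?thesis by (intro bexI[of _ "2*s+1"]) auto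
    next
      assume "u = 3*s"
      with s aX show ?thesis by (intro bexI[of _ "2*s+1"]) auto
    next
      assume "u = s"
      with s aX show ?thesis by (intro bexI[of _ "1"]) auto
    next
      assume "u = s+1"
      with s aX show ?thesis by (intro bexI[of _ "1"]) auto
    next
      assume "u = 2*s"
      with s aX show ?thesis by (intro bexI[of _ "2*s-1"]) auto
    next
      assume "u = 4*s-1"
      with s aX show ?thesis by (intro bexI[of _ "2*s-1"]) auto
    next
      assume "(s+2 \<le> u \<and> u \<le> 2*s-1)"
      with s aO2[of "2*s-u"] show ?thesis by (intro bexI[of _ "2 * (2*s-u) + 1"]) auto
    next
      assume "(2*s+2 \<le> u \<and> u \<le> 3*s-1)"
      with s aO2[of "u-2*s-1"] show ?thesis by (intro bexI[of _ "2 * (u-2*s-1) + 1"]) auto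
    qed
  qed
  have "(4 * s - 1) mod 4 = 3" by presburger
  then have "skolem (4 * s - 1) a"
    using cov s aX by (auto simp: skolem_def intro!: bexI[of _ "4 * s - 1"])
  then  show ?thesis by blast
qed

lemma skolem_exists:
  assumes "1 \<le> t"
  shows "\<exists>a. skolem t a"
proof -
  consider "t = 1" | "t = 2" | "t = 3" | "t = 4" | "t = 5" | s where "t = 4 * s" "2 \<le> s"
    | s where "t = 4 * s + 1" "2 \<le> s" | s where "t = 4 * s + 2" "1 \<le> s"
    | s where "t = 4 * s - 1" "2 \<le> s"
  proof -
    have "t = 1 \<or> t = 2 \<or> t = 3 \<or> t = 4 \<or> t = 5 \<or> (\<exists>s\<ge>2. t = 4 * s) \<or> (\<exists>s\<ge>2. t = 4 * s + 1)
      \<or> (\<exists>s\<ge>1. t = 4 * s + 2) \<or> (\<exists>s\<ge>2. t = 4 * s - 1)"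
      using assms by presburger
    with that show ?thesis by blast
  qed
  then show ?thesis
    by cases (use skolem_small skolem_exists_mod_0 skolem_exists_mod_1 skolem_exists_mod_2 skolem_exists_mod_3 in blast)+
qed

section \<open>Signed sums\<close>

definition signed_sum :: "'i set \<Rightarrow> ('i \<Rightarrow> int) \<Rightarrow> int \<Rightarrow> bool" where
  "signed_sum I x c \<longleftrightarrow> (\<exists>\<epsilon>. (\<forall>i\<in>I. \<epsilon> i = 1 \<or> \<epsilon> i = -1) \<and> (\<Sum>i\<in>I. \<epsilon> i * x i) = c)"

lemma signed_sum_empty: "signed_sum {} x 0"
  by (simp add: signed_sum_def)

lemma signed_sum_uminus:
  assumes "signed_sum I x c"
  shows "signed_sum I x (- c)"
proof -
  obtain \<epsilon> where "\<forall>i\<in>I. \<epsilon> i = 1 \<or> \<epsilon> i = -1" "(\<Sum>i\<in>I. \<epsilon> i * x i) = c"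
    using assms by (auto simp: signed_sum_def)
  then show ?thesis
    unfolding signed_sum_def by (intro exI[of _ "\<lambda>i. - \<epsilon> i"]) (auto simp: sum_negf)
qed

lemma signed_sum_insert_sign:
  assumes "finite I" "i \<notin> I" "s = 1 \<or> s = -1" "signed_sum I x (c - s * x i)"
  shows "signed_sum (insert i I) x c"
proof -
  obtain \<epsilon> where e: "\<forall>j\<in>I. \<epsilon> j = 1 \<or> \<epsilon> j = -1" "(\<Sum>j\<in>I. \<epsilon> j * x j) = c - s * x i"
    using assms(4) by (auto simp: signed_sum_def)
  have "(\<Sum>j\<in>I. (\<epsilon>(i := s)) j * x j) = (\<Sum>j\<in>I. \<epsilon> j * x j)"
    using assms(2) by (intro sum.cong) auto
  then have "(\<Sum>j\<in>insert i I. (\<epsilon>(i := s)) j * x j) = c"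
    using assms(1,2) e(2) by simp
  moreover have "\<forall>j\<in>insert i I. (\<epsilon>(i := s)) j = 1 \<or> (\<epsilon>(i := s)) j = -1"
    using e(1) assms(3) by simp
  ultimately show ?thesis unfolding signed_sum_def by blast
qed

lemma signed_sum_insert_plus:
  "finite I \<Longrightarrow> i \<notin> I \<Longrightarrow> signed_sum I x (c - x i) \<Longrightarrow> signed_sum (insert i I) x c"
  using signed_sum_insert_sign[of I i 1] by simp

lemma signed_sum_insert_minus:
  "finite I \<Longrightarrow> i \<notin> I \<Longrightarrow> signed_sum I x (c + x i) \<Longrightarrow> signed_sum (insert i I) x c"
  using signed_sum_insert_sign[of I i "-1"] by simp

lemma signed_sum_cong:
  assumes "signed_sum I x c" "\<And>i. i \<in> I \<Longrightarrow> x i = y i"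
  shows "signed_sum I y c"
  using assms unfolding signed_sum_def by (metis (mono_tags, lifting) sum.cong)

lemma signed_sum_reindex:
  assumes "bij_betw h I J" "signed_sum J x c"
  shows "signed_sum I (x \<circ> h) c"
proof -
  obtain \<epsilon> where e: "\<forall>i\<in>J. \<epsilon> i = 1 \<or> \<epsilon> i = -1" "(\<Sum>i\<in>J. \<epsilon> i * x i) = c"
    using assms by (auto simp: signed_sum_def)
  have "(\<Sum>i\<in>I. \<epsilon> (h i) * x (h i)) = c"
    using sum.reindex_bij_betw[OF assms(1), of "\<lambda>i. \<epsilon> i * x i"] e by simp
  then show ?thesis
    using e bij_betwE[OF assms(1)] unfolding signed_sum_def
    by (intro exI[of _ "\<epsilon> \<circ> h"]) auto
qed

lemma sum_from_two:
  assumes "1 \<le> t"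
  shows "2 * \<Sum>{2..t::int} = t * (t + 1) - 2"
  using assms
proof (induction t rule: int_ge_induct)
  case base
  then show ?case by simp
next
  case (step t)
  then have "{2..t + 1} = insert (t + 1) {2..t}" by auto
  then show ?case using step by (simp add: algebra_simps)
qed

text \<open>The full sum minus 2 has the right parity but would need the sign of a 1 to be changed,
  hence the margin 3. In the induction \<open>t + 1\<close> gets the sign that pulls
  \<open>v\<close> towards 0.\<close>

lemma signed_sum_from_two:
  assumes "4 \<le> t" "\<bar>v\<bar> \<le> \<Sum>{2..t} - 3" "even (v + \<Sum>{2..t})"
  shows "signed_sum {2..t::int} (\<lambda>d. d) v"
proof -
  \<comment> \<open>The additional bound keeps the remaining target in range when \<open>v\<close>
    is close to 0.\<close>
  have "t + 5 \<le> \<Sum>{2..t} \<and> (\<forall>v. \<bar>v\<bar> \<le> \<Sum>{2..t} - 3 \<longrightarrow> even (v + \<Sum>{2..t}) \<longrightarrow>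
    signed_sum {2..t} (\<lambda>d. d) v)"
    using assms(1)
  proof (induction t rule: int_ge_induct)
    case base
    have 4: "{2..4::int} = {2,3,4}" by auto
    have ins: "signed_sum {2,3,4} (\<lambda>d. d) (2 + 3 - 4::int)" "signed_sum {2,3,4} (\<lambda>d. d) (2 - 3 + 4::int)"
      "signed_sum {2,3,4} (\<lambda>d. d) (-2 + 3 + 4::int)"
      unfolding signed_sum_def
      by (rule exI[of _ "\<lambda>d. if d = 4 then -1 else 1"], simp)
        (rule exI[of _ "\<lambda>d. if d = 3 then -1 else 1"], simp,
         rule exI[of _ "\<lambda>d. if d = 2 then -1 else 1"], simp)
    have *: "signed_sum {2,3,4} (\<lambda>d. d) v" if "\<bar>v\<bar> \<le> 6" "odd v" for v :: int
    proof -
      have "v = 1 \<or> v = 3 \<or> v = 5 \<or> v = -1 \<or> v = -3 \<or> v = -5"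
        using that by presburger
      then show ?thesis using ins ins[THEN signed_sum_uminus] by auto
    qed
    show ?case using * unfolding 4 by simp
  next
    case (step t)
    have eq: "{2..t + 1} = insert (t + 1) {2..t}" using step by auto
    then have eq2: "\<Sum>{2..t + 1} = \<Sum>{2..t} + (t + 1)" by simp
    have "signed_sum {2..t + 1} (\<lambda>d. d) v" if v: "\<bar>v\<bar> \<le> \<Sum>{2..t + 1} - 3" "even (v + \<Sum>{2..t + 1})" for v
    proof (cases "0 \<le> v")
      case True
      then have "\<bar>v - (t + 1)\<bar> \<le> \<Sum>{2..t} - 3" "even (v - (t + 1) + \<Sum>{2..t})"
        using v step.hyps step.IH[THEN conjunct1] unfolding eq2 by (auto simp: abs_le_iff)
      then show ?thesis unfolding eq using step.IH by (intro signed_sum_insert_plus) auto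
    next
      case False
      then have "\<bar>v + (t + 1)\<bar> \<le> \<Sum>{2..t} - 3" "even (v + (t + 1) + \<Sum>{2..t})"
        using v step.hyps step.IH[THEN conjunct1] unfolding eq2 by (auto simp: abs_le_iff)
      then show ?thesis unfolding eq using step.IH by (intro signed_sum_insert_minus) auto
    qed
    moreover have "t + 1 + 5 \<le> \<Sum>{2..t + 1}" using step unfolding eq2 by linarith
    ultimately show ?case by blast
  qed
  then show ?thesis using assms by blast
qed

text \<open>For \<open>4 \<le> k\<close> the summand 1 gets a plus sign and
  \<open>signed_sum_from_two\<close> handles the rest. The last assumption excludes
  \<open>k = 0\<close> with \<open>v = 2\<close>, which has the right parity but no
  solution.\<close>

lemma signed_sum_from_one_small:
  fixes k v :: int
  assumes "0 \<le> k" "0 \<le> v" "v \<le> 2" "even (v + \<Sum>{1..k})" "k < 3 \<longrightarrow> v \<le> k"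
  shows "signed_sum {1..k} (\<lambda>d. d) v"
proof (cases "4 \<le> k")
  case True
  then have eq: "{1..k} = insert 1 {2..k}" by auto
  then have sum: "\<Sum>{1..k} = 1 + \<Sum>{2..k}" by simp
  have "2 * 10 \<le> k * (k + 1)" using True mult_mono[of 4 k 5 "k + 1"] by simp
  then have "9 \<le> \<Sum>{2..k}" using sum_from_two[of k] True by linarith
  then have "signed_sum {2..k} (\<lambda>d. d) (v - 1)"
    using assms True unfolding sum by (intro signed_sum_from_two) auto
  then show ?thesis unfolding eq by (intro signed_sum_insert_plus) auto
next
  case False
  have 123: "{1..0::int} = {}" "{1..1::int} = {1}" "{1..2::int} = {1,2}" "{1..3::int} = {1,2,3}" by auto
  have ins: "signed_sum {1,2} (\<lambda>d. d) (2 - 1::int)" "signed_sum {1,2,3} (\<lambda>d. d) (1 + 2 - 3::int)"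
      "signed_sum {1,2,3} (\<lambda>d. d) (1 - 2 + 3::int)" "signed_sum {1} (\<lambda>d. d) (1::int)"
      unfolding signed_sum_def
      by (rule exI[of _ "\<lambda>d. if d = 1 then -1 else 1"], simp)
        (rule exI[of _ "\<lambda>d. if d = 3 then -1 else 1"], simp,
         rule exI[of _ "\<lambda>d. if d = 2 then -1 else 1"], simp, rule exI[of _ "\<lambda>d. 1"], simp)
  have "k = 0 \<or> k = 1 \<or> k = 2 \<or> k = 3" "v = 0 \<or> v = 1 \<or> v = 2" using assms False by auto
  then show ?thesis using assms ins by (elim disjE) (simp_all add: 123 signed_sum_empty)
qed

text \<open>Serves the situation where one star gives up its difference \<open>e\<close> because
  another of its labels is selected. If \<open>t - 1\<close> or \<open>t - 2\<close> is removed, the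
  two largest numbers left contribute 2 or 1 with opposite signs, and \<open>{1..t - 3}\<close>
  remains.\<close>

lemma signed_sum_delete:
  fixes t e :: int
  assumes "2 \<le> t" "e \<in> {1..t}" "e = 1 \<or> t - 2 \<le> e"
  shows "signed_sum ({1..t} - {e}) (\<lambda>d. d) 1 \<or> signed_sum ({1..t} - {e}) (\<lambda>d. d) 2"
proof -
  \<comment> \<open>The parity of the full sum decides which of the two values is attained.\<close>
  have zero_one: "signed_sum {1..k} (\<lambda>d. d) 0 \<or> signed_sum {1..k} (\<lambda>d. d) 1" if "0 \<le> k" for k :: int
    using signed_sum_from_one_small[of k 0] signed_sum_from_one_small[of k 1] that
    by (cases "k = 0") auto
  consider "e = t" | "e = t - 1" "3 \<le> t" | "e = t - 2" "3 \<le> t" | "e = 1" "2 \<le> t" "t \<le> 3" | "e = 1" "4 \<le> t"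
    using assms by force
  then show ?thesis
  proof cases
    case 1
    then have eq: "{1..t} - {e} = {1..t - 1}" by auto
    have "even (1 + \<Sum>{1..t - 1}) \<or> even (2 + \<Sum>{1..t - 1})" by auto
    moreover have "\<not> even (2 + \<Sum>{1..t - 1})" if "t - 1 < 2"
    proof -
      have "{1..t - 1} = {1}" using that assms by auto
      then show ?thesis by simp
    qed
    moreover have "\<not> even (2 + \<Sum>{1..t - 1})" if "t - 1 = 2"
    proof -
      have "{1..t - 1} = {1, 2}" using that assms by auto
      then show ?thesis by simp
    qed
    ultimately show ?thesis unfolding eq
      using signed_sum_from_one_small[of "t - 1" 1] signed_sum_from_one_small[of "t - 1" 2] assms
      by force
  next
    case 2
    then have eq: "{1..t} - {e} = insert t (insert (t - 2) {1..t - 3})" by auto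
    have "signed_sum (insert t (insert (t - 2) {1..t - 3})) (\<lambda>d. d) c"
      if "signed_sum {1..t - 3} (\<lambda>d. d) (c - 2)" for c
      by (rule signed_sum_insert_plus, simp, simp, rule signed_sum_insert_minus) (use that in \<open>auto simp: algebra_simps\<close>)
    moreover have "signed_sum {1..t - 3} (\<lambda>d. d) (2 - 2) \<or> signed_sum {1..t - 3} (\<lambda>d. d) (1 - 2)"
      using zero_one[of "t - 3"] signed_sum_uminus[of "{1..t - 3}" "\<lambda>d. d" 1] 2 by auto
    ultimately show ?thesis unfolding eq by blast
  next
    case 3
    then have eq: "{1..t} - {e} = insert t (insert (t - 1) {1..t - 3})" by auto
    have "signed_sum (insert t (insert (t - 1) {1..t - 3})) (\<lambda>d. d) c"
      if "signed_sum {1..t - 3} (\<lambda>d. d) (c - 1)" for c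
      by (rule signed_sum_insert_plus, simp, simp, rule signed_sum_insert_minus) (use that in \<open>auto simp: algebra_simps\<close>)
    moreover have "signed_sum {1..t - 3} (\<lambda>d. d) (2 - 1) \<or> signed_sum {1..t - 3} (\<lambda>d. d) (1 - 1)"
      using zero_one[of "t - 3"] 3 by auto
    ultimately show ?thesis unfolding eq by blast
  next
    case 4
    then have eq: "{1..t} - {e} = {2} \<or> {1..t} - {e} = {2, 3}" by auto
    have "signed_sum {2} (\<lambda>d. d) (2::int)" "signed_sum {2, 3} (\<lambda>d. d) (3 - 2::int)"
      unfolding signed_sum_def
      by (rule exI[of _ "\<lambda>d. 1"], simp) (rule exI[of _ "\<lambda>d. if d = 2 then -1 else 1"], simp)
    with eq show ?thesis by fastforce
  next
    case 5
    then have eq: "{1..t} - {e} = {2..t}" by auto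
    have "2 * 10 \<le> t * (t + 1)" using 5 mult_mono[of 4 t 5 "t + 1"] by simp
    then have "9 \<le> \<Sum>{2..t}" using sum_from_two[of t] 5 by linarith
    then show ?thesis unfolding eq
      using signed_sum_from_two[of t 1] signed_sum_from_two[of t 2] 5 by auto
  qed
qed

section \<open>Stars of size 3 and 5\<close>

definition labels :: "nat \<Rightarrow> int set" where
  "labels M = gap_interval (M mod 4 \<in> {1, 2}) (int M)"

definition top_label :: "nat \<Rightarrow> int" where
  "top_label M = (if M mod 4 \<in> {1, 2} then int M + 1 else int M)"

text \<open>Absolute values are the labels; a positive sign will mean an arc into the centre of the
  star.\<close>

definition star_system :: "'i set \<Rightarrow> ('i \<Rightarrow> nat) \<Rightarrow> ('i \<Rightarrow> int list) \<Rightarrow> bool" where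
  "star_system I n f \<longleftrightarrow> (\<forall>i\<in>I. length (f i) = n i \<and> sum_list (f i) = 0) \<and>
     labels (sum n I) \<subseteq> (\<Union>i\<in>I. abs ` set (f i))"

text \<open>
  The \<open>d\<close>-th star contains the label \<open>d\<close>. The last two claims provide the alternative selections that
  repair the parity at the centre of the snowflake, in the presence of one even star and of none.
\<close>

lemma odd_core:
  fixes t q :: int
  assumes t: "1 \<le> t" and q: "0 \<le> q" "q \<le> t"
    and n: "\<And>d. n d = (if d \<le> q then 5 else 3::nat)"
  obtains f where "star_system {1..t} n f" "\<And>d. d \<in> {1..t} \<Longrightarrow> d \<in> abs ` set (f d)"
    "\<exists>e\<in>{1..t}. (e = 1 \<or> t - 2 \<le> e) \<and> top_label (sum n {1..t}) \<in> abs ` set (f e)"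
    "t mod 4 \<in> {1, 2} \<and> 5 \<le> t \<longrightarrow> (\<exists>V\<ge>0. 2 * (V + 1) \<le> t * (t + 1) - 8 \<and>
       V \<in> abs ` set (f 1) \<and> V + 1 \<in> abs ` set (f 1))"
proof -
  obtain a where a: "skolem t a" using skolem_exists[OF t] by blast
  define hook where "hook \<longleftrightarrow> t mod 4 \<in> {2, 3}"
  have cover: "\<exists>e\<in>{1..t}. u = a e \<or> u = a e + e" if "u \<in> gap_interval hook (2 * t)" for u
    using a that by (simp add: skolem_def hook_def)
  obtain m where m: "m \<in> {max 1 (t - 1)..t}" "a m + m = (if hook then 2 * t + 1 else 2 * t)"
    using a unfolding skolem_def hook_def by blast
  have a1: "0 \<le> a 1" "2 * (t + a 1 + 1) \<le> t * (t + 1) - 8" if "t mod 4 \<in> {1, 2}" "5 \<le> t"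
    using a that by (auto simp: skolem_def)
  \<comment> \<open>Layout of the labels: the differences \<open>1..t\<close>, then adjacent twos up
    to \<open>s\<close>, then the Skolem positions shifted by \<open>s\<close>.\<close>
  define s where "s = t + 2 * (if odd q then q - 1 else q)"
  \<comment> \<open>For odd \<open>q\<close>, star 1 has no partner and takes \<open>U\<close> and
    \<open>U + 2\<close>. In the hooked case \<open>U\<close> is the hole below the hook; otherwise
    \<open>U + 1\<close> becomes a new gap.\<close>
  define U where "U = s + 2 * t + (if hook then 0 else 1)"
  \<comment> \<open>For odd \<open>q\<close> there are only \<open>q - 1\<close> adjacent twos. Star
    \<open>q\<close> gets the Skolem pair of distance 1 instead, whose labels are adjacent and which
    no other star takes.\<close>
  define adj where "adj d = (if d < q \<or> even q then t + 2 * d - 1 else s + a 1)" for d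
  \<comment> \<open>Partners among the 5-stars are 1 and 2, 3 and 4, and so on for even
    \<open>q\<close>, and 2 and 3, 4 and 5, and so on for odd \<open>q\<close>. They exchange Skolem
    pairs, and the adjacent two makes up the discrepancy 1.\<close>
  define f where "f d = (if q < d then [d, s + a d, - (s + a d + d)]
    else if odd q \<and> d = 1 then [1, - adj 1, adj 1 + 1, U, - (U + 2)]
    else if odd d \<noteq> odd q then [d, - adj d, adj d + 1, s + a (d + 1), - (s + a (d + 1) + (d + 1))]
    else [d, adj d, - (adj d + 1), s + a (d - 1), - (s + a (d - 1) + (d - 1))])" for d
  have len: "length (f d) = n d" and zero: "sum_list (f d) = 0" for d
    by (auto simp: f_def n)
  have self: "d \<in> abs ` set (f d)" if "1 \<le> d" for d
    using that by (auto simp: f_def)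
  have adj: "v \<in> abs ` set (f d)" if "1 \<le> d" "d \<le> q" "v = adj d \<or> v = adj d + 1" "0 \<le> v" for v d
    using that by (auto simp: f_def)
  \<comment> \<open>The exchange moves a Skolem pair by at most one star, except that for odd
    \<open>q\<close> the pair of distance 1 goes to star \<open>q\<close>. The lower bound on
    \<open>d\<close> is used to locate the top label.\<close>
  have pair: "\<exists>d\<in>{1..t}. v \<in> abs ` set (f d) \<and> (odd q \<or> e - 1 \<le> d)"
    if "e \<in> {1..t}" "v = s + a e \<or> v = s + a e + e" "0 \<le> v" for v e
  proof -
    consider "q < e" | "e \<le> q" "odd q" "e = 1" | "e \<le> q" "odd e \<noteq> odd q"
      | "e \<le> q" "odd e = odd q" "\<not> (odd q \<and> e = 1)" by linarith
    then show ?thesis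
    proof cases
      case 1
      then show ?thesis using that by (intro bexI[of _ e]) (auto simp: f_def)
    next
      case 2
      have "v \<in> abs ` set (f q)" using that 2 by (intro adj) (auto simp: adj_def)
      then show ?thesis using 2 q by (intro bexI[of _ q]) auto
    next
      case 3
      then have "e + 1 \<le> q" by (cases "e = q") auto
      with 3 that q show ?thesis by (intro bexI[of _ "e + 1"]) (auto simp: f_def)
    next
      case 4
      then have "2 \<le> e" "\<not> (odd q \<and> e = 2)" using that by (cases "e = 1"; auto)+
      with 4 that q show ?thesis by (intro bexI[of _ "e - 1"]) (auto simp: f_def)
    qed
  qed
  have sum_n: "int (sum n {1..t}) = 3 * t + 2 * q"
  proof -
    have "sum n {1..t} = (\<Sum>d\<in>{1..t}. 3 + (if d \<in> {1..q} then 2 else 0))"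
      by (intro sum.cong) (auto simp: n)
    also have "\<dots> = 3 * nat t + (\<Sum>d\<in>{1..t} \<inter> {1..q}. 2)"
      by (subst sum.distrib, subst sum.inter_restrict[symmetric]) simp_all
    also have "{1..t} \<inter> {1..q} = {1..q}" using q by auto
    finally show ?thesis using q t by simp
  qed
  define M where "M = sum n {1..t}"
  have M: "int M = 3 * t + 2 * q" using sum_n by (simp add: M_def)
  have hookM: "M mod 4 \<in> {1, 2} \<longleftrightarrow> hook \<noteq> odd q"
  proof -
    \<comment> \<open>Only \<open>t mod 4\<close> and \<open>q mod 2\<close> matter, which leaves
      eight cases.\<close>
    define r b where "r = t mod 4" and "b = q mod 2"
    have "int M = 4 * (3 * (t div 4) + q div 2) + (3 * r + 2 * b)"
      unfolding M r_def b_def using mult_div_mod_eq[of 4 t] mult_div_mod_eq[of 2 q] by (smt (verit))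
    then have "int (M mod 4) = (3 * r + 2 * b) mod 4"
      by (simp only: of_nat_mod of_nat_numeral mod_mult_self4)
    moreover have "r \<in> {0, 1, 2, 3}" "b \<in> {0, 1}" by (auto simp: r_def b_def)
    moreover have "odd q \<longleftrightarrow> b = 1" by (simp add: b_def odd_iff_mod_2_eq_one)
    ultimately show ?thesis by (auto simp: hook_def simp flip: r_def)
  qed
  \<comment> \<open>For odd \<open>q\<close> the top label is \<open>U + 2\<close>, in star 1.
    Otherwise it is the last shifted position, in a star of index at least \<open>m - 1\<close>,
    hence at least \<open>t - 2\<close>.\<close>
  have topM: "top_label M = s + (if odd q then U + 2 - s else a m + m)"
    using m(2) M hookM by (auto simp: top_label_def s_def U_def)
  have topU: "v \<in> abs ` set (f 1)" if "odd q" "v = U \<or> v = U + 2" for v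
  proof -
    have "1 \<le> q" using that(1) q by (cases "q = 0") auto
    moreover have "0 \<le> U" using t q by (auto simp: U_def s_def)
    ultimately show ?thesis using that by (auto simp: f_def)
  qed
  show ?thesis
  proof
    have "v \<in> (\<Union>d\<in>{1..t}. abs ` set (f d))" if v: "v \<in> labels M" for v
    proof -
      have v1: "1 \<le> v" using v M t q by (auto simp: labels_def gap_interval_def split: if_splits)
      consider "v \<le> t" | "t < v" "v \<le> s" | "s < v" by linarith
      then show ?thesis
      proof cases
        case 1
        then show ?thesis using self[OF v1] v1 by auto
      next
        case 2
        \<comment> \<open>This inverts \<open>adj\<close>: \<open>v\<close> is one of the two
          adjacent labels numbered \<open>d\<close>.\<close>
        define d where "d = (v - t + 1) div 2"
        have d: "1 \<le> d" "d < q \<or> even q" "d \<le> q" "v = t + 2 * d - 1 \<or> v = t + 2 * d"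
          using 2 unfolding d_def s_def by (auto split: if_splits)
        have "v \<in> abs ` set (f d)" using d v1 by (intro adj) (auto simp: adj_def)
        then show ?thesis using d q by (intro UN_I[of d]) auto
      next
        case 3
        consider "v - s \<in> gap_interval hook (2 * t)" | "odd q" "v = U \<or> v = U + 2"
          using v 3 M t q hookM unfolding labels_def gap_interval_def U_def s_def
          by (auto split: if_splits; linarith)
        then show ?thesis
        proof cases
          case 1
          then obtain e where "e \<in> {1..t}" "v - s = a e \<or> v - s = a e + e" using cover by blast
          then show ?thesis using pair[of e v] v1 by (auto simp: algebra_simps)
        next
          case 2
          then show ?thesis using topU t by (intro UN_I[of 1]) auto
        qed
      qed
    qed
    then show "star_system {1..t} n f"
      unfolding star_system_def M_def[symmetric] using len zero by blast
    show "d \<in> abs ` set (f d)" if "d \<in> {1..t}" for d using self that by simp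
    show "\<exists>e\<in>{1..t}. (e = 1 \<or> t - 2 \<le> e) \<and> top_label (sum n {1..t}) \<in> abs ` set (f e)"
    proof (cases "odd q")
      case True
      then show ?thesis unfolding M_def[symmetric] topM using topU t by (intro bexI[of _ 1]) auto
    next
      case False
      have "0 \<le> s + a m + m" using m t q False by (auto simp: s_def split: if_splits)
      then obtain d where "d \<in> {1..t}" "s + a m + m \<in> abs ` set (f d)" "m - 1 \<le> d"
        using pair[of m "s + a m + m"] False m by auto
      moreover have "top_label (sum n {1..t}) = s + a m + m"
        using topM False by (simp add: M_def)
      moreover have "t - 2 \<le> d" using \<open>m - 1 \<le> d\<close> m by auto
      ultimately show ?thesis by (intro bexI[of _ d]) simp_all
    qed
    show "t mod 4 \<in> {1, 2} \<and> 5 \<le> t \<longrightarrow> (\<exists>V\<ge>0. 2 * (V + 1) \<le> t * (t + 1) - 8 \<and>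
       V \<in> abs ` set (f 1) \<and> V + 1 \<in> abs ` set (f 1))"
    proof
      assume t5: "t mod 4 \<in> {1, 2} \<and> 5 \<le> t"
      \<comment> \<open>The bound says that \<open>V + 1\<close> is at most the sum of
        \<open>{2..t}\<close> minus 3, the range of \<open>signed_sum_from_two\<close>. For
        \<open>q \<le> 1\<close> star 1 holds the Skolem pair of distance 1; for larger
        \<open>q\<close> it holds the adjacent labels \<open>t + 1\<close> and
        \<open>t + 2\<close>.\<close>
      consider "q = 0" | "q = 1" | "2 \<le> q" using q by linarith
      then show "\<exists>V\<ge>0. 2 * (V + 1) \<le> t * (t + 1) - 8 \<and> V \<in> abs ` set (f 1) \<and> V + 1 \<in> abs ` set (f 1)"
      proof cases
        case 1
        then show ?thesis using a1 t5 t by (intro exI[of _ "t + a 1"]) (auto simp: f_def s_def algebra_simps)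
      next
        case 2
        then show ?thesis using a1 t5 t
          by (intro exI[of _ "t + a 1"]) (auto simp: f_def adj_def s_def algebra_simps)
      next
        case 3
        have "5 * t \<le> t * t" using t5 by (intro mult_right_mono) auto
        moreover have "t * (t + 1) = t * t + t" by (simp add: distrib_left)
        ultimately have "2 * (t + 1 + 1) \<le> t * (t + 1) - 8" using t5 by (smt (verit))
        moreover have "adj 1 = t + 1" using 3 by (auto simp: adj_def)
        ultimately show ?thesis using adj[of 1 "t + 1"] adj[of 1 "t + 1 + 1"] 3 t
          by (intro exI[of _ "t + 1"]) auto
      qed
    qed
  qed
qed

section \<open>Stars of even size\<close>

text \<open>The block takes up the label missing from \<open>labels M\<close>, if there is one. Four
  labels preserve the presence or absence of a gap, six labels toggle it. The listed members let a
  selection use a difference of 1 or 2 against the old top label, and pass a top label on to the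
  next block.\<close>

lemma even_block:
  assumes "k = 4 \<or> k = 6"
  obtains xs where "length xs = k" "sum_list xs = 0" "labels (M + k) \<subseteq> labels M \<union> abs ` set xs"
    "{top_label M + 1, top_label M + 2, top_label (M + k)} \<subseteq> abs ` set xs"
proof -
  define m where "m = int M"
  have m: "0 \<le> m" by (simp add: m_def)
  have six: "(M + 6) mod 4 \<in> {1, 2} \<longleftrightarrow> \<not> M mod 4 \<in> {1, 2}" by simp presburger
  have four: "(M + 4) mod 4 = M mod 4" by simp
  define xs where "xs = (if k = 4
    then (if M mod 4 \<in> {1, 2} then [m, - (m + 2), - (m + 3), m + 5]
          else [m + 1, - (m + 2), - (m + 3), m + 4])
    else (if M mod 4 \<in> {1, 2} then [m, - (m + 2), - (m + 3), m + 4, - (m + 5), m + 6]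
          else [m + 1, - (m + 2), m + 3, - (m + 4), - (m + 5), m + 7]))"
  show ?thesis
  proof
    show "length xs = k" "sum_list xs = 0" using assms by (auto simp: xs_def)
    show "labels (M + k) \<subseteq> labels M \<union> abs ` set xs"
    proof
      fix v assume v: "v \<in> labels (M + k)"
      show "v \<in> labels M \<union> abs ` set xs"
      proof (cases "M mod 4 \<in> {1, 2}")
        case True
        then show ?thesis using v assms six m unfolding labels_def gap_interval_def xs_def four
          by (elim disjE) (simp_all add: m_def[symmetric], (smt (verit))+)
      next
        case False
        then show ?thesis using v assms six m unfolding labels_def gap_interval_def xs_def four
          by (elim disjE) (simp_all add: m_def[symmetric], (smt (verit))+)
      qed
    qed
    show "{top_label M + 1, top_label M + 2, top_label (M + k)} \<subseteq> abs ` set xs"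
    proof (cases "M mod 4 \<in> {1, 2}")
      case True
      then show ?thesis using assms six m unfolding top_label_def xs_def four
        by (elim disjE) (simp_all add: m_def[symmetric])
    next
      case False
      then show ?thesis using assms six m unfolding top_label_def xs_def four
        by (elim disjE) (simp_all add: m_def[symmetric])
    qed
  qed
qed

lemma star_system_insert_even:
  assumes "star_system I n f" "finite I" "i \<notin> I" "n i = 4 \<or> n i = 6"
  obtains xs where "star_system (insert i I) n (f(i := xs))"
    "top_label (sum n I) + 1 \<in> abs ` set xs" "top_label (sum n I) + 2 \<in> abs ` set xs"
    "top_label (sum n (insert i I)) \<in> abs ` set xs"
proof -
  obtain xs where xs: "length xs = n i" "sum_list xs = 0"
    "labels (sum n I + n i) \<subseteq> labels (sum n I) \<union> abs ` set xs"
    "{top_label (sum n I) + 1, top_label (sum n I) + 2, top_label (sum n I + n i)} \<subseteq> abs ` set xs"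
    using even_block[OF assms(4)] by metis
  have sum: "sum n (insert i I) = sum n I + n i" using assms by simp
  have "(\<Union>j\<in>insert i I. abs ` set ((f(i := xs)) j)) = abs ` set xs \<union> (\<Union>j\<in>I. abs ` set (f j))"
    using assms(3) by (auto split: if_splits)
  then have "star_system (insert i I) n (f(i := xs))"
    using assms xs unfolding star_system_def sum by auto
  with xs(4) that show ?thesis by (simp only: sum insert_subset)
qed

text \<open>A block of four has sum zero, so instead of becoming a star it can be appended to star
  \<open>i\<close>.\<close>

lemma star_system_grow:
  assumes "star_system I n f" "finite I" "i \<in> I"
  obtains xs where "star_system I (n(i := n i + 4)) (f(i := f i @ xs))"
proof -
  obtain xs where xs: "length xs = 4" "sum_list xs = 0"
    "labels (sum n I + 4) \<subseteq> labels (sum n I) \<union> abs ` set xs"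
    using even_block[of 4] by metis
  have sum: "sum (n(i := n i + 4)) I = sum n I + 4"
  proof -
    have "sum (n(i := n i + 4)) (I - {i}) = sum n (I - {i})" by (intro sum.cong) auto
    then show ?thesis using assms by (simp add: sum.remove[of I i])
  qed
  define g where "g = f(i := f i @ xs)"
  have sub: "abs ` set (f j) \<subseteq> abs ` set (g j)" "abs ` set xs \<subseteq> abs ` set (g i)" for j
    by (auto simp: g_def)
  have "labels (sum n I) \<subseteq> (\<Union>j\<in>I. abs ` set (f j))"
    using assms(1) by (simp add: star_system_def)
  also have "\<dots> \<subseteq> (\<Union>j\<in>I. abs ` set (g j))" using sub(1) by (intro UN_mono) auto
  finally have "labels (sum n I) \<union> abs ` set xs \<subseteq> (\<Union>j\<in>I. abs ` set (g j))"
    using sub(2) UN_upper[OF assms(3), of "\<lambda>j. abs ` set (g j)"] by (meson Un_least order_trans)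
  with xs(3) have "labels (sum n I + 4) \<subseteq> (\<Union>j\<in>I. abs ` set (g j))"
    by (rule order_trans)
  moreover have "\<forall>j\<in>I. length (g j) = (n(i := n i + 4)) j \<and> sum_list (g j) = 0"
    using assms(1) xs by (simp add: star_system_def g_def)
  ultimately have "star_system I (n(i := n i + 4)) (f(i := f i @ xs))"
    unfolding star_system_def sum g_def[symmetric] by blast
  with that show ?thesis by blast
qed

text \<open>Blocks of four are appended one at a time. Old labels stay in their stars, so a
  selection made for the smaller sizes remains available.\<close>

lemma star_system_extend:
  assumes "star_system I n f" "finite I"
  shows "\<exists>g. star_system I (\<lambda>i. n i + 4 * k i) g \<and> (\<forall>i\<in>I. set (f i) \<subseteq> set (g i))"
proof (induction "sum k I" arbitrary: k)
  case 0
  then have k: "k i = 0" if "i \<in> I" for i using assms that by simp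
  then have "sum (\<lambda>i. n i + 4 * k i) I = sum n I" by (intro sum.cong) auto
  then have "star_system I (\<lambda>i. n i + 4 * k i) f"
    using assms k by (simp add: star_system_def)
  then show ?case by blast
next
  case (Suc K)
  then obtain i where i: "i \<in> I" "k i \<noteq> 0" by (metis sum.neutral nat.distinct(1))
  define k' where "k' = k(i := k i - 1)"
  have "sum k I = Suc (sum k' I)"
  proof -
    have "sum k' (I - {i}) = sum k (I - {i})" unfolding k'_def by (intro sum.cong) auto
    then show ?thesis using i assms by (simp add: sum.remove[of I i] k'_def)
  qed
  then obtain g where g: "star_system I (\<lambda>i. n i + 4 * k' i) g" "\<forall>i\<in>I. set (f i) \<subseteq> set (g i)"
    using Suc by (metis Suc_inject)
  have eq: "(\<lambda>i. n i + 4 * k i) = (\<lambda>i. n i + 4 * k' i)(i := (n i + 4 * k' i) + 4)"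
    using i by (auto simp: k'_def fun_eq_iff)
  obtain xs where "star_system I (\<lambda>i. n i + 4 * k i) (g(i := g i @ xs))"
    using star_system_grow[OF g(1) assms(2) i(1)] unfolding eq by blast
  moreover have "\<forall>j\<in>I. set (f j) \<subseteq> set ((g(i := g i @ xs)) j)" using g(2) by auto
  ultimately show ?case by blast
qed

section \<open>Signed sums attainable by selecting one label per star\<close>

definition reachable :: "'i set \<Rightarrow> ('i \<Rightarrow> nat) \<Rightarrow> int \<Rightarrow> bool" where
  "reachable I n c \<longleftrightarrow>
     (\<exists>f x. star_system I n f \<and> (\<forall>i\<in>I. x i \<in> abs ` set (f i)) \<and> signed_sum I x c)"

text \<open>Adding two even stars preserves this condition and makes 0 reachable.\<close>

definition flexible :: "'i set \<Rightarrow> ('i \<Rightarrow> nat) \<Rightarrow> bool" where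
  "flexible I n \<longleftrightarrow> reachable I n 1 \<or> reachable I n 0 \<and> reachable I n 2"

lemma reachable_uminus: "reachable I n c \<Longrightarrow> reachable I n (- c)"
  unfolding reachable_def using signed_sum_uminus by blast

text \<open>Star \<open>a\<close> goes on top first and holds the new top label \<tau>; star
  \<open>b\<close> goes above it and holds \<tau> + 1 and \<tau> + 2. Selecting \<tau> and \<tau> +
  \<delta> with opposite signs shifts the sum by \<delta> either way.\<close>

lemma reachable_insert_pair:
  assumes "reachable I n c" "finite I" "a \<notin> I" "b \<notin> I" "a \<noteq> b"
    and "n a = 4 \<or> n a = 6" "n b = 4 \<or> n b = 6" "\<delta> = 1 \<or> \<delta> = 2"
  shows "reachable (insert b (insert a I)) n (c + \<delta>)" "reachable (insert b (insert a I)) n (c - \<delta>)"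
proof -
  obtain f x where f: "star_system I n f" "\<forall>i\<in>I. x i \<in> abs ` set (f i)" "signed_sum I x c"
    using assms(1) unfolding reachable_def by blast
  define \<tau> where "\<tau> = top_label (sum n (insert a I))"
  obtain xs where xs: "star_system (insert a I) n (f(a := xs))" "\<tau> \<in> abs ` set xs"
    unfolding \<tau>_def by (rule star_system_insert_even[OF f(1) assms(2,3,6)])
  obtain ys where ys: "star_system (insert b (insert a I)) n (f(a := xs, b := ys))"
      "\<tau> + 1 \<in> abs ` set ys" "\<tau> + 2 \<in> abs ` set ys"
    unfolding \<tau>_def by (rule star_system_insert_even[OF xs(1), of b]) (use assms in auto)
  define y where "y = x(a := \<tau>, b := \<tau> + \<delta>)"
  have y: "y a = \<tau>" "y b = \<tau> + \<delta>" "signed_sum I y c"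
    using assms f(3) by (auto simp: y_def intro: signed_sum_cong)
  have "signed_sum (insert b (insert a I)) y (c + \<delta>)"
    by (rule signed_sum_insert_plus, use assms in simp, use assms in simp,
      rule signed_sum_insert_minus) (use assms y in simp_all)
  moreover have "signed_sum (insert b (insert a I)) y (c - \<delta>)"
    by (rule signed_sum_insert_minus, use assms in simp, use assms in simp,
      rule signed_sum_insert_plus) (use assms y in simp_all)
  moreover have "\<forall>i\<in>insert b (insert a I). y i \<in> abs ` set ((f(a := xs, b := ys)) i)"
    using f xs ys assms by (auto simp: y_def)
  ultimately show "reachable (insert b (insert a I)) n (c + \<delta>)"
    "reachable (insert b (insert a I)) n (c - \<delta>)"
    unfolding reachable_def using ys(1) by metis+
qed

text \<open>From 1 the shifts lead to 0 and -1, and a sum may be negated; from 2 and 0 they lead to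
  0 and 1.\<close>

lemma flexible_insert_pair:
  assumes "flexible I n" "finite I" "a \<notin> I" "b \<notin> I" "a \<noteq> b"
    and "n a = 4 \<or> n a = 6" "n b = 4 \<or> n b = 6"
  shows "reachable (insert b (insert a I)) n 0 \<and> reachable (insert b (insert a I)) n 1"
proof -
  let ?J = "insert b (insert a I)"
  have pair: "reachable ?J n (c + \<delta>)" "reachable ?J n (c - \<delta>)"
    if "reachable I n c" "\<delta> = 1 \<or> \<delta> = 2" for c \<delta>
    using reachable_insert_pair[OF that(1) assms(2-7) that(2)] by auto
  show ?thesis
  proof (cases "reachable I n 1")
    case True
    then have "reachable ?J n (1 - 1)" "reachable ?J n (- (1 - 2))"
      using pair(2)[of 1 1] reachable_uminus[OF pair(2)[of 1 2]] by blast+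
    then show ?thesis by simp
  next
    case False
    then have "reachable ?J n (2 - 2)" "reachable ?J n (0 + 1)"
      using assms(1) pair(2)[of 2 2] pair(1)[of 0 1] unfolding flexible_def by blast+
    then show ?thesis by simp
  qed
qed

lemma flexible_Un_even:
  assumes "flexible I n" "finite I" "finite E" "E \<inter> I = {}" "\<forall>i\<in>E. n i = 4 \<or> n i = 6" "card E = 2 * k"
  shows "flexible (I \<union> E) n \<and> (E \<noteq> {} \<longrightarrow> reachable (I \<union> E) n 0)"
  using assms(3-6)
proof (induction k arbitrary: E)
  case 0
  then show ?case using assms(1) by simp
next
  case (Suc k)
  then have "card E = Suc (Suc (2 * k))" by simp
  then obtain a b E' where E: "E = insert b (insert a E')" "a \<notin> E'" "b \<notin> insert a E'" "card E' = 2 * k"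
    by (metis card_Suc_eq)
  have E': "finite E'" "E' \<inter> I = {}" "\<forall>i\<in>E'. n i = 4 \<or> n i = 6" using Suc.prems E by auto
  have flex: "flexible (I \<union> E') n" using Suc.IH[OF E' E(4)] by blast
  have "reachable (insert b (insert a (I \<union> E'))) n 0 \<and> reachable (insert b (insert a (I \<union> E'))) n 1"
    using Suc.prems E E' assms(2) by (intro flexible_insert_pair[OF flex]) auto
  moreover have "insert b (insert a (I \<union> E')) = I \<union> E" using E by auto
  ultimately show ?case by (simp add: flexible_def)
qed

section \<open>Selecting labels for the centre\<close>

text \<open>Transfers \<open>odd_core\<close> to an arbitrary index set; \<open>h\<close> numbers
  the stars with those of size 5 first.\<close>

lemma odd_stars:
  assumes "finite J" "J \<noteq> {}" "\<forall>i\<in>J. n i = 3 \<or> n i = 5"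
  defines "t \<equiv> int (card J)"
  obtains f h where "bij_betw h J {1..t}" "star_system J n f" "\<forall>i\<in>J. h i \<in> abs ` set (f i)"
    "\<exists>i\<in>J. (h i = 1 \<or> t - 2 \<le> h i) \<and> top_label (sum n J) \<in> abs ` set (f i)"
    "t mod 4 \<in> {1, 2} \<and> 5 \<le> t \<longrightarrow> (\<exists>i\<in>J. h i = 1 \<and> (\<exists>V\<ge>0. 2 * (V + 1) \<le> t * (t + 1) - 8 \<and>
       V \<in> abs ` set (f i) \<and> V + 1 \<in> abs ` set (f i)))"
proof -
  define A where "A = {i\<in>J. n i = 5}"
  define q where "q = int (card A)"
  have A: "finite A" "A \<subseteq> J" using assms by (auto simp: A_def)
  have t: "1 \<le> t" using assms by (simp add: t_def Suc_le_eq card_gt_0_iff)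
  have q: "0 \<le> q" "q \<le> t" using A assms(1) by (auto simp: q_def t_def card_mono)
  have cJ: "card (J - A) = card J - card A" "card A \<le> card J"
    using A assms(1) by (auto simp: card_Diff_subset card_mono)
  have "card A = card {1..q}" by (simp add: q_def)
  then obtain h1 where h1: "bij_betw h1 A {1..q}"
    using finite_same_card_bij[OF A(1) finite_atLeastAtMost_int] by blast
  have "card (J - A) = card {q + 1..t}" using cJ by (simp add: q_def t_def)
  then obtain h2 where h2: "bij_betw h2 (J - A) {q + 1..t}"
    using finite_same_card_bij[OF finite_Diff[OF assms(1)] finite_atLeastAtMost_int] by blast
  define h where "h i = (if i \<in> A then h1 i else h2 i)" for i
  have "bij_betw h A {1..q}" using h1 by (subst bij_betw_cong[of _ _ h1]) (auto simp: h_def)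
  moreover have "bij_betw h (J - A) {q + 1..t}"
    using h2 by (subst bij_betw_cong[of _ _ h2]) (auto simp: h_def)
  ultimately have "bij_betw h (A \<union> (J - A)) ({1..q} \<union> {q + 1..t})" by (rule bij_betw_combine) auto
  moreover have "A \<union> (J - A) = J" "{1..q} \<union> {q + 1..t} = {1..t}" using A q by auto
  ultimately have h: "bij_betw h J {1..t}" by simp
  define n' where "n' d = (if d \<le> q then 5 else 3::nat)" for d
  have nh: "n i = n' (h i)" if "i \<in> J" for i
  proof (cases "i \<in> A")
    case True
    then show ?thesis using bij_betwE[OF h1] by (auto simp: n'_def h_def A_def)
  next
    case False
    then have "h2 i \<in> {q + 1..t}" using bij_betwE[OF h2] that by blast
    then show ?thesis using False that assms(3) by (auto simp: n'_def h_def A_def)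
  qed
  obtain f where f: "star_system {1..t} n' f" "\<And>d. d \<in> {1..t} \<Longrightarrow> d \<in> abs ` set (f d)"
    "\<exists>e\<in>{1..t}. (e = 1 \<or> t - 2 \<le> e) \<and> top_label (sum n' {1..t}) \<in> abs ` set (f e)"
    "t mod 4 \<in> {1, 2} \<and> 5 \<le> t \<longrightarrow> (\<exists>V\<ge>0. 2 * (V + 1) \<le> t * (t + 1) - 8 \<and>
       V \<in> abs ` set (f 1) \<and> V + 1 \<in> abs ` set (f 1))"
    by (rule odd_core[OF t q, of n']) (auto simp: n'_def)
  have sum: "sum n J = sum n' {1..t}"
    using sum.reindex_bij_betw[OF h, of n'] nh by simp
  have img: "h ` J = {1..t}" using h by (simp add: bij_betw_def)
  obtain j1 where j1: "j1 \<in> J" "h j1 = 1" using img t by (metis atLeastAtMost_iff imageE order_refl)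
  show ?thesis
  proof
    show "bij_betw h J {1..t}" by (fact h)
    have hJ: "h i \<in> {1..t}" if "i \<in> J" for i using img that by blast
    have "(\<Union>i\<in>J. abs ` set ((f \<circ> h) i)) = (\<Union>d\<in>{1..t}. abs ` set (f d))"
      unfolding img[symmetric] by simp
    then show "star_system J n (f \<circ> h)"
      using f(1) nh hJ unfolding star_system_def sum by simp
    show "\<forall>i\<in>J. h i \<in> abs ` set ((f \<circ> h) i)" using f(2)[OF hJ] by simp
    show "\<exists>i\<in>J. (h i = 1 \<or> t - 2 \<le> h i) \<and> top_label (sum n J) \<in> abs ` set ((f \<circ> h) i)"
      using f(3) unfolding sum img[symmetric] by auto
    show "t mod 4 \<in> {1, 2} \<and> 5 \<le> t \<longrightarrow> (\<exists>i\<in>J. h i = 1 \<and> (\<exists>V\<ge>0. 2 * (V + 1) \<le> t * (t + 1) - 8 \<and>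
       V \<in> abs ` set ((f \<circ> h) i) \<and> V + 1 \<in> abs ` set ((f \<circ> h) i)))"
      using f(4) j1 by (metis comp_apply)
  qed
qed

lemma even_sum_iff:
  assumes "0 \<le> (t::int)"
  shows "even (\<Sum>{1..t}) \<longleftrightarrow> t mod 4 \<in> {0, 3}"
  using assms
proof (induction t rule: int_ge_induct)
  case base
  then show ?case by simp
next
  case (step t)
  then have "{1..t + 1} = insert (t + 1) {1..t}" by auto
  then have "even (\<Sum>{1..t + 1}) \<longleftrightarrow> (even (t + 1) = even (\<Sum>{1..t}))" by simp
  also have "\<dots> \<longleftrightarrow> (t + 1) mod 4 \<in> {0, 3}"
  proof -
    define r where "r = t mod 4"
    have "r \<in> {0, 1, 2, 3}" by (auto simp: r_def)
    moreover have "even t \<longleftrightarrow> even r" by (simp add: r_def dvd_mod_iff)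
    moreover have "(t + 1) mod 4 = (r + 1) mod 4" by (simp add: r_def mod_simps)
    ultimately show ?thesis using step.IH by (auto simp flip: r_def)
  qed
  finally show ?case .
qed

text \<open>Selecting the differences yields signed sums of \<open>1..t\<close>, all of one parity.
  If that parity is odd and there are at least three stars, then \<open>5 \<le> t\<close>, and star
  1 offers two consecutive labels in place of 1. One of them has the parity of the sum of
  \<open>{2..t}\<close> and can be cancelled by these numbers.\<close>

lemma odd_stars_flexible:
  assumes "finite J" "J \<noteq> {}" "\<forall>i\<in>J. n i = 3 \<or> n i = 5"
  shows "flexible J n" "3 \<le> card J \<longrightarrow> reachable J n 0"
proof -
  define t where "t = int (card J)"
  obtain f h where h: "bij_betw h J {1..t}" and f: "star_system J n f" "\<forall>i\<in>J. h i \<in> abs ` set (f i)"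
    and flip: "t mod 4 \<in> {1, 2} \<and> 5 \<le> t \<longrightarrow> (\<exists>i\<in>J. h i = 1 \<and> (\<exists>V\<ge>0. 2 * (V + 1) \<le> t * (t + 1) - 8 \<and>
       V \<in> abs ` set (f i) \<and> V + 1 \<in> abs ` set (f i)))"
    using odd_stars[OF assms] unfolding t_def by metis
  have t: "1 \<le> t" using assms by (simp add: t_def Suc_le_eq card_gt_0_iff)
  have reach: "reachable J n c" if "0 \<le> c" "c \<le> 2" "even (c + \<Sum>{1..t})" "t < 3 \<longrightarrow> c \<le> t" for c
  proof -
    have "signed_sum {1..t} (\<lambda>d. d) c" using signed_sum_from_one_small that t by simp
    from signed_sum_reindex[OF h this] show ?thesis
      using f unfolding reachable_def by (auto simp: comp_def)
  qed
  have mod: "t mod 4 = 0 \<or> t mod 4 = 1 \<or> t mod 4 = 2 \<or> t mod 4 = 3" by presburger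
  show "flexible J n"
  proof (cases "even (\<Sum>{1..t})")
    case True
    then have "3 \<le> t" using even_sum_iff[of t] t by (cases "t = 1"; cases "t = 2") auto
    with True show ?thesis unfolding flexible_def using reach[of 0] reach[of 2] by simp
  next
    case False
    then show ?thesis unfolding flexible_def using reach[of 1] t by simp
  qed
  show "3 \<le> card J \<longrightarrow> reachable J n 0"
  proof
    assume "3 \<le> card J"
    then have t3: "3 \<le> t" by (simp add: t_def)
    show "reachable J n 0"
    proof (cases "t mod 4 \<in> {1, 2}")
      case False
      then have "even (\<Sum>{1..t})" using even_sum_iff[of t] t mod by auto
      then show ?thesis using reach[of 0] t by simp
    next
      case True
      then have "t \<noteq> 3" "t \<noteq> 4" by auto
      then have t5: "5 \<le> t" using t3 by linarith
      then obtain i V where iV: "i \<in> J" "h i = 1" "0 \<le> V" "2 * (V + 1) \<le> t * (t + 1) - 8"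
        "V \<in> abs ` set (f i)" "V + 1 \<in> abs ` set (f i)" using flip True by blast
      obtain W where W: "W \<in> abs ` set (f i)" "W = V \<or> W = V + 1" "even (W + \<Sum>{2..t})"
        using iV(5,6) by (cases "even (V + \<Sum>{2..t})") (auto intro: that)
      have "\<bar>W\<bar> \<le> \<Sum>{2..t} - 3" using W(2) iV(3,4) sum_from_two[OF t] by (smt (verit))
      then have "signed_sum {2..t} (\<lambda>d. d) W" using signed_sum_from_two W(3) t5 by simp
      then have "signed_sum {2..t} (\<lambda>d. if d = 1 then W else d) W"
        by (rule signed_sum_cong) auto
      then have "signed_sum (insert 1 {2..t}) (\<lambda>d. if d = 1 then W else d) 0"
        by (intro signed_sum_insert_minus) auto
      moreover have "insert 1 {2..t} = {1..t}" using t by auto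
      ultimately have "signed_sum {1..t} (\<lambda>d. if d = 1 then W else d) 0" by simp
      note s = signed_sum_reindex[OF h this]
      have "((\<lambda>d. if d = 1 then W else d) \<circ> h) j \<in> abs ` set (f j)" if "j \<in> J" for j
      proof (cases "h j = 1")
        case True
        then have "j = i" using h that iV(1,2) by (metis bij_betw_inv_into_left)
        then show ?thesis using W iV by simp
      next
        case False
        then show ?thesis using f that by simp
      qed
      then show ?thesis using s f(1) unfolding reachable_def by blast
    qed
  qed
qed

text \<open>Some odd star \<open>e\<close> holds the top label \<tau> of the odd stars, and the even
  star above holds \<tau> + 1 and \<tau> + 2. Selecting labels from these two contributes 1 or 2 up
  to sign, and by \<open>signed_sum_delete\<close> the other differences reach 1 or 2. A single odd
  star leaves no other differences, hence the condition for reaching 0.\<close>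

lemma odd_stars_insert_even:
  assumes "finite J" "J \<noteq> {}" "\<forall>i\<in>J. n i = 3 \<or> n i = 5" "a \<notin> J" "n a = 4 \<or> n a = 6"
  shows "flexible (insert a J) n" "2 \<le> card J \<longrightarrow> reachable (insert a J) n 0"
proof -
  define t where "t = int (card J)"
  define \<tau> where "\<tau> = top_label (sum n J)"
  obtain f h e where h: "bij_betw h J {1..t}" and f: "star_system J n f" "\<forall>i\<in>J. h i \<in> abs ` set (f i)"
    and e: "e \<in> J" "h e = 1 \<or> t - 2 \<le> h e" "\<tau> \<in> abs ` set (f e)"
    using odd_stars[OF assms(1-3)] unfolding t_def \<tau>_def by metis
  have t: "1 \<le> t" using assms by (simp add: t_def Suc_le_eq card_gt_0_iff)
  obtain xs where xs: "star_system (insert a J) n (f(a := xs))" "\<tau> + 1 \<in> abs ` set xs" "\<tau> + 2 \<in> abs ` set xs"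
    unfolding \<tau>_def by (rule star_system_insert_even[OF f(1) assms(1,4,5)])
  have he: "h e \<in> {1..t}" using h e(1) by (auto simp: bij_betw_def)
  have hd: "bij_betw h (J - {e}) ({1..t} - {h e})"
    using h e(1) inj_on_image_set_diff[of h J J "{e}"] by (auto simp: bij_betw_def intro: inj_on_diff)
  have reach: "reachable (insert a J) n (c - \<delta>)"
    if c: "signed_sum ({1..t} - {h e}) (\<lambda>d. d) c" and \<delta>: "\<delta> = 1 \<or> \<delta> = 2" for c \<delta>
  proof -
    define x where "x = (h :: _ \<Rightarrow> int)(e := \<tau>, a := \<tau> + \<delta>)"
    have ea: "e \<noteq> a" using e(1) assms(4) by auto
    have "signed_sum (J - {e}) x c"
      using signed_sum_reindex[OF hd c] by (rule signed_sum_cong) (use assms(4) in \<open>auto simp: x_def\<close>)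
    then have "signed_sum (insert e (J - {e})) x (c + \<tau>)"
      using assms(1) ea by (intro signed_sum_insert_plus) (auto simp: x_def)
    then have "signed_sum J x (c + \<tau>)" using e(1) by (simp add: insert_absorb)
    then have "signed_sum (insert a J) x (c - \<delta>)"
      using assms(1,4) by (intro signed_sum_insert_minus) (auto simp: x_def)
    moreover have "\<forall>i\<in>insert a J. x i \<in> abs ` set ((f(a := xs)) i)"
      using f(2) xs(2,3) e(3) \<delta> assms(4) by (auto simp: x_def)
    ultimately show ?thesis unfolding reachable_def using xs(1) by metis
  qed
  have two: "reachable (insert a J) n 0 \<and> reachable (insert a J) n 1" if t2: "2 \<le> t"
  proof -
    consider "signed_sum ({1..t} - {h e}) (\<lambda>d. d) 1" | "signed_sum ({1..t} - {h e}) (\<lambda>d. d) 2"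
      using signed_sum_delete[OF t2 he e(2)] by blast
    then show ?thesis
    proof cases
      case 1
      then show ?thesis using reach[of 1 1] reachable_uminus[OF reach[of 1 2]] by simp
    next
      case 2
      then show ?thesis using reach[of 2 2] reach[of 2 1] by simp
    qed
  qed
  then show "2 \<le> card J \<longrightarrow> reachable (insert a J) n 0" by (simp add: t_def)
  show "flexible (insert a J) n"
  proof (cases "2 \<le> t")
    case True
    then show ?thesis using two by (simp add: flexible_def)
  next
    case False
    then have "{1..t} - {h e} = {}" using he t by auto
    then have "reachable (insert a J) n (- (0 - 1))"
      using reachable_uminus[OF reach[of 0 1]] signed_sum_empty by metis
    then show ?thesis by (simp add: flexible_def)
  qed
qed

text \<open>Above the empty system the top label is 0, so the star contains the label 1.\<close>

lemma even_star_flexible: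
  assumes "n a = 4 \<or> n a = 6"
  shows "flexible {a} n"
proof -
  have "star_system {} n f" for f by (simp add: star_system_def labels_def gap_interval_def)
  then obtain xs f where "star_system {a} n (f(a := xs))" "top_label (sum n {}) + 1 \<in> abs ` set xs"
    using star_system_insert_even[of "{}" n _ a] assms by (metis empty_iff finite.emptyI)
  moreover have "signed_sum {a} (\<lambda>_. 1) 1"
    by (rule signed_sum_insert_plus) (simp_all add: signed_sum_empty)
  ultimately have "reachable {a} n 1"
    unfolding reachable_def by (intro exI[of _ "f(a := xs)"] exI[of _ "\<lambda>_. 1"]) (simp add: top_label_def)
  then show ?thesis by (simp add: flexible_def)
qed

lemma even_pair_flexible:
  assumes "n a = 4 \<or> n a = 6" "n b = 4 \<or> n b = 6" "a \<noteq> b"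
  shows "flexible {b, a} n"
proof -
  have "star_system {} n f" for f by (simp add: star_system_def labels_def gap_interval_def)
  then have "reachable {} n 0" unfolding reachable_def using signed_sum_empty by blast
  then have "reachable {b, a} n (0 + 1)" using assms by (intro reachable_insert_pair) auto
  then show ?thesis by (simp add: flexible_def)
qed

text \<open>The base consists of all odd stars, with one even star added if the number of even stars
  is odd; without odd stars it consists of one or two even stars. The remaining even stars are then
  added in twos.\<close>

lemma reduced_stars:
  assumes fin: "finite I" and I: "I \<noteq> {}" and n: "\<forall>i\<in>I. n i \<in> {3, 4, 5, 6}"
  shows "flexible I n \<and> (3 \<le> card I \<longrightarrow> reachable I n 0)"
proof -
  define E where "E = {i\<in>I. n i = 4 \<or> n i = 6}"
  define J where "J = {i\<in>I. n i = 3 \<or> n i = 5}"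
  have IJ: "I = J \<union> E" "J \<inter> E = {}" "finite J" "finite E" using n fin by (auto simp: E_def J_def)
  have card: "card I = card J + card E" using IJ by (simp add: card_Un_disjoint)
  have even: "flexible (K \<union> E') n \<and> (E' \<noteq> {} \<longrightarrow> reachable (K \<union> E') n 0)"
    if "flexible K n" "finite K" "E' \<inter> K = {}" "E' \<subseteq> E" "even (card E')" for K E'
  proof -
    have "finite E'" using that(4) IJ(4) by (rule finite_subset)
    moreover have "\<forall>i\<in>E'. n i = 4 \<or> n i = 6" using that(4) by (auto simp: E_def)
    ultimately show ?thesis using that by (elim evenE) (rule flexible_Un_even)
  qed
  have J: "\<forall>i\<in>J. n i = 3 \<or> n i = 5" and En: "\<And>i. i \<in> E \<Longrightarrow> n i = 4 \<or> n i = 6"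
    by (auto simp: J_def E_def)
  show ?thesis
  proof (cases "even (card E)")
    case True
    show ?thesis
    proof (cases "J = {}")
      case False
      note odd = odd_stars_flexible[OF IJ(3) False J]
      have "flexible (J \<union> E) n \<and> (E \<noteq> {} \<longrightarrow> reachable (J \<union> E) n 0)"
        using IJ True by (intro even odd(1)) auto
      then show ?thesis using odd(2) IJ(1) by (cases "E = {}") auto
    next
      case JE: True
      then have "card E \<noteq> 0" using IJ I by simp
      then obtain m where "card E = Suc (Suc m)" "even m" using True by (cases "card E"; cases "card E - 1") auto
      then obtain a b E' where E': "E = insert b (insert a E')" "a \<notin> E'" "b \<notin> insert a E'" "card E' = m"
        by (metis card_Suc_eq)
      have "flexible ({b, a} \<union> E') n \<and> (E' \<noteq> {} \<longrightarrow> reachable ({b, a} \<union> E') n 0)"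
        using E' En \<open>even m\<close> by (intro even even_pair_flexible) auto
      moreover have "I = {b, a} \<union> E'" using IJ JE E' by auto
      moreover have "card {b, a} \<le> 2" using card_insert_le_m1[of 2 "{a}" b] by simp
      ultimately show ?thesis by (cases "E' = {}") auto
    qed
  next
    case False
    then have "card E \<noteq> 0" by (cases "card E = 0") auto
    then obtain m where "card E = Suc m" "even m" using False by (cases "card E") auto
    then obtain a E' where E': "E = insert a E'" "a \<notin> E'" "card E' = m"
      by (metis card_Suc_eq)
    have a: "n a = 4 \<or> n a = 6" using En E' by blast
    show ?thesis
    proof (cases "J = {}")
      case False
      have aJ: "a \<notin> J" using IJ(2) E'(1) by blast
      note odd = odd_stars_insert_even[OF IJ(3) False J aJ a]
      have "flexible (insert a J \<union> E') n \<and> (E' \<noteq> {} \<longrightarrow> reachable (insert a J \<union> E') n 0)"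
        using IJ E' \<open>even m\<close> by (intro even odd(1)) auto
      moreover have "I = insert a J \<union> E'" using IJ(1) E'(1) by blast
      moreover have "card (insert a J) = Suc (card J)" using aJ IJ(3) by simp
      ultimately show ?thesis using odd(2) by (cases "E' = {}") auto
    next
      case True
      have "flexible ({a} \<union> E') n \<and> (E' \<noteq> {} \<longrightarrow> reachable ({a} \<union> E') n 0)"
        using E' a \<open>even m\<close> by (intro even even_star_flexible) auto
      moreover have "I = {a} \<union> E'" using IJ(1) E'(1) True by blast
      ultimately show ?thesis by (cases "E' = {}") auto
    qed
  qed
qed

section \<open>Star lists for arbitrary sizes, with the selected signed label in front\<close>

lemma rotate_to_head:
  fixes xs :: "int list"
  assumes "v \<in> set xs" "sum_list xs = 0" "w = v \<or> w = - v"
  obtains ys where "ys \<noteq> []" "hd ys = w" "length ys = length xs" "sum_list ys = 0"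
    "abs ` set ys = abs ` set xs"
proof -
  obtain as bs where xs: "xs = as @ v # bs" using split_list[OF assms(1)] by blast
  define zs where "zs = v # as @ bs"
  have zs: "length zs = length xs" "sum_list zs = 0" "set zs = set xs"
    using assms(2) by (auto simp: zs_def xs)
  show ?thesis
  proof (cases "w = v")
    case True
    show ?thesis by (rule that[of zs]) (use zs True in \<open>auto simp: zs_def\<close>)
  next
    case False
    have "sum_list (map uminus zs) = - sum_list zs" using uminus_sum_list_map[of "\<lambda>x. x" zs] by (simp add: comp_def)
    moreover have "abs ` set (map uminus zs) = abs ` set zs" by (simp add: image_image)
    moreover have "hd (map uminus zs) = w" using False assms(3) by (auto simp: zs_def)
    moreover have "map uminus zs \<noteq> []" by (simp add: zs_def)
    ultimately show ?thesis using zs by (intro that[of "map uminus zs"]) simp_all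
  qed
qed

text \<open>Multiples of four are removed until the sizes lie between 3 and 6, labels are selected
  there, and the fours are put back. The head of a list stands for the edge at the centre of the
  snowflake.\<close>

lemma balanced_star_lists:
  fixes n :: "nat \<Rightarrow> nat"
  assumes "1 \<le> p" "\<forall>i<p. 3 \<le> n i"
  obtains f where "star_system {..<p} n f" "3 \<le> p \<longrightarrow> (\<Sum>i<p. hd (f i)) = 0"
proof -
  define k where "k i = (n i - 3) div 4" for i
  define n0 where "n0 i = 3 + (n i - 3) mod 4" for i
  have n0: "n i = n0 i + 4 * k i" if "i < p" for i
    using assms(2) that by (auto simp: n0_def k_def)
  have "n0 i \<in> {3, 4, 5, 6}" for i unfolding n0_def by (auto; presburger)
  then have red: "flexible {..<p} n0 \<and> (3 \<le> p \<longrightarrow> reachable {..<p} n0 0)"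
    using reduced_stars[of "{..<p}" n0] assms(1) by (auto simp: lessThan_empty_iff)
  \<comment> \<open>With fewer than three stars the centre is unconstrained, so any reachable value
    serves.\<close>
  obtain c where c: "reachable {..<p} n0 c" "3 \<le> p \<longrightarrow> c = 0"
    using red unfolding flexible_def by (cases "3 \<le> p") auto
  obtain f x where f: "star_system {..<p} n0 f" "\<forall>i<p. x i \<in> abs ` set (f i)" "signed_sum {..<p} x c"
    using c(1) unfolding reachable_def by auto
  obtain \<epsilon> where \<epsilon>: "\<forall>i<p. \<epsilon> i = 1 \<or> \<epsilon> i = -1" "(\<Sum>i<p. \<epsilon> i * x i) = c"
    using f(3) unfolding signed_sum_def by auto
  obtain g where g: "star_system {..<p} (\<lambda>i. n0 i + 4 * k i) g" "\<forall>i<p. set (f i) \<subseteq> set (g i)"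
    using star_system_extend[OF f(1), of k] by auto
  have "\<exists>ys. ys \<noteq> [] \<and> hd ys = \<epsilon> i * x i \<and> length ys = n i \<and> sum_list ys = 0 \<and>
    abs ` set ys = abs ` set (g i)" if i: "i < p" for i
  proof -
    obtain v where v: "v \<in> set (f i)" "x i = \<bar>v\<bar>" using f(2) i by blast
    have "v \<in> set (g i)" "length (g i) = n i" "sum_list (g i) = 0"
      using v g i n0 by (auto simp: star_system_def)
    moreover have "\<epsilon> i * x i = v \<or> \<epsilon> i * x i = - v" using \<epsilon>(1) i v by auto
    ultimately show ?thesis by (metis rotate_to_head)
  qed
  then obtain F where F: "\<And>i. i < p \<Longrightarrow> hd (F i) = \<epsilon> i * x i \<and> length (F i) = n i \<and> sum_list (F i) = 0 \<and>
    abs ` set (F i) = abs ` set (g i)" by metis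
  have "sum (\<lambda>i. n0 i + 4 * k i) {..<p} = sum n {..<p}" using n0 by simp
  moreover have "(\<Union>i\<in>{..<p}. abs ` set (F i)) = (\<Union>i\<in>{..<p}. abs ` set (g i))" using F by simp
  ultimately have "star_system {..<p} n F" using g(1) F by (simp add: star_system_def)
  moreover have "(\<Sum>i<p. hd (F i)) = c" using F \<epsilon>(2) by simp
  ultimately show ?thesis using that c(2) by blast
qed

section \<open>Labelings of the snowflake\<close>

lemma orientation_sum_incident:
  fixes g :: "'a set \<Rightarrow> nat"
  assumes A: "orientation E A" and E: "finite E" "\<forall>e\<in>E. card e = 2"
  shows "(\<Sum>e\<in>{e\<in>E. u \<in> e}. g e) = (\<Sum>v | (v, u) \<in> A. g {u, v}) + (\<Sum>v | (u, v) \<in> A. g {u, v})"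
proof -
  have bij: "bij_betw (\<lambda>(u, v). {u, v}) A E" using A by (simp add: orientation_def)
  then have inj: "inj_on (\<lambda>(u, v). {u, v}) A" and img: "(\<lambda>(u, v). {u, v}) ` A = E"
    by (auto simp: bij_betw_def)
  have finA: "finite A" using bij E(1) bij_betw_finite by blast
  have loop: "x \<noteq> y" if "(x, y) \<in> A" for x y
  proof
    assume "x = y"
    then have "{x} \<in> E" using img that by force
    then show False using E(2) by force
  qed
  have anti: "(y, x) \<notin> A" if "(x, y) \<in> A" for x y
  proof
    assume "(y, x) \<in> A"
    then have "(x, y) = (y, x)" using inj_onD[OF inj _ that] by (auto simp: insert_commute)
    then show False using loop[OF that] by simp
  qed
  let ?in = "{v. (v, u) \<in> A}" and ?out = "{v. (u, v) \<in> A}"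
  have fin: "finite ?in" "finite ?out"
    using finite_subset[of ?in "fst ` A"] finite_subset[of ?out "snd ` A"] finA by force+
  have inc: "{e\<in>E. u \<in> e} = (\<lambda>v. {u, v}) ` (?in \<union> ?out)"
    unfolding img[symmetric] by (auto simp: insert_commute)
  have "inj_on (\<lambda>v. {u, v}) (?in \<union> ?out)" by (auto simp: inj_on_def doubleton_eq_iff)
  then have "(\<Sum>e\<in>{e\<in>E. u \<in> e}. g e) = (\<Sum>v\<in>?in \<union> ?out. g {u, v})"
    unfolding inc by (subst sum.reindex) auto
  also have "\<dots> = (\<Sum>v\<in>?in. g {u, v}) + (\<Sum>v\<in>?out. g {u, v})"
    using fin anti by (intro sum.union_disjoint) auto
  finally show ?thesis .
qed

text \<open>Incoming and outgoing labels have equal totals, so the sum over all incident edges is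
  twice one of them.\<close>

lemma even_sum_incident:
  assumes "orientation E A" "finite E" "\<forall>e\<in>E. card e = 2" "vertex_sum A \<phi> u = 0"
  shows "even (\<Sum>e\<in>{e\<in>E. u \<in> e}. \<phi> e)"
proof -
  have "int (\<Sum>v | (v, u) \<in> A. \<phi> {u, v}) = int (\<Sum>v | (u, v) \<in> A. \<phi> {u, v})"
    using assms(4) by (simp add: vertex_sum_def)
  then have "(\<Sum>v | (v, u) \<in> A. \<phi> {u, v}) = (\<Sum>v | (u, v) \<in> A. \<phi> {u, v})"
    by (simp only: of_nat_eq_iff)
  then show ?thesis using orientation_sum_incident[OF assms(1-3)] by simp
qed

text \<open>An edge is directed towards \<open>c k\<close> if \<open>s k\<close> is positive and
  away from it otherwise, so it contributes \<open>s k\<close> at \<open>c k\<close> and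
  \<open>- s k\<close> at \<open>l k\<close>.\<close>

lemma signed_edge_labeling:
  fixes c l :: "'k \<Rightarrow> 'a" and s :: "'k \<Rightarrow> int"
  assumes K: "finite K" and cl: "\<forall>k\<in>K. c k \<noteq> l k" and inj: "inj_on (\<lambda>k. {c k, l k}) K"
    and E: "E = (\<lambda>k. {c k, l k}) ` K" and s: "\<forall>k\<in>K. s k \<noteq> 0"
  shows "\<exists>A \<phi>. orientation E A \<and> (\<forall>k\<in>K. \<phi> {c k, l k} = nat \<bar>s k\<bar>) \<and>
    (\<forall>u. vertex_sum A \<phi> u = (\<Sum>k\<in>{k\<in>K. c k = u}. s k) - (\<Sum>k\<in>{k\<in>K. l k = u}. s k))"
proof -
  define hd where "hd k = (if 0 < s k then c k else l k)" for k
  define tl where "tl k = (if 0 < s k then l k else c k)" for k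
  define A where "A = (\<lambda>k. (tl k, hd k)) ` K"
  define \<phi> where "\<phi> e = nat \<bar>s (inv_into K (\<lambda>k. {c k, l k}) e)\<bar>" for e
  have edge: "{tl k, hd k} = {c k, l k}" "{hd k, tl k} = {c k, l k}" for k
    by (auto simp: hd_def tl_def)
  have \<phi>: "\<phi> {c k, l k} = nat \<bar>s k\<bar>" if "k \<in> K" for k
    using inv_into_f_f[OF inj that] by (simp add: \<phi>_def)
  have eqI: "k = k'" if "k \<in> K" "k' \<in> K" "{tl k, hd k} = {tl k', hd k'}" for k k'
    using inj_onD[OF inj] that by (simp add: edge)
  have "inj_on (\<lambda>(u, v). {u, v}) A" by (auto simp: A_def inj_on_def dest: eqI)
  moreover have "(\<lambda>(u, v). {u, v}) ` A = E" by (simp add: A_def E image_image edge)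
  ultimately have "orientation E A" by (simp add: orientation_def bij_betw_def)
  moreover have "vertex_sum A \<phi> u = (\<Sum>k\<in>{k\<in>K. c k = u}. s k) - (\<Sum>k\<in>{k\<in>K. l k = u}. s k)" for u
  proof -
    have "{v. (v, u) \<in> A} = tl ` {k\<in>K. hd k = u}" by (auto simp: A_def)
    moreover have "inj_on tl {k\<in>K. hd k = u}" by (rule inj_onI) (auto intro: eqI)
    ultimately have "(\<Sum>v | (v, u) \<in> A. int (\<phi> {u, v})) = (\<Sum>k\<in>{k\<in>K. hd k = u}. int (\<phi> {u, tl k}))"
      by (simp add: sum.reindex)
    also have "\<dots> = (\<Sum>k\<in>{k\<in>K. hd k = u}. \<bar>s k\<bar>)"
      by (intro sum.cong) (auto simp: edge \<phi>)
    finally have 1: "(\<Sum>v | (v, u) \<in> A. int (\<phi> {u, v})) = (\<Sum>k\<in>K. if hd k = u then \<bar>s k\<bar> else 0)"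
      using K by (simp add: sum.inter_filter)
    have "{v. (u, v) \<in> A} = hd ` {k\<in>K. tl k = u}" by (auto simp: A_def)
    moreover have "inj_on hd {k\<in>K. tl k = u}" by (rule inj_onI) (auto intro: eqI)
    ultimately have "(\<Sum>v | (u, v) \<in> A. int (\<phi> {u, v})) = (\<Sum>k\<in>{k\<in>K. tl k = u}. int (\<phi> {u, hd k}))"
      by (simp add: sum.reindex)
    also have "\<dots> = (\<Sum>k\<in>{k\<in>K. tl k = u}. \<bar>s k\<bar>)"
      by (intro sum.cong) (auto simp: edge \<phi>)
    finally have 2: "(\<Sum>v | (u, v) \<in> A. int (\<phi> {u, v})) = (\<Sum>k\<in>K. if tl k = u then \<bar>s k\<bar> else 0)"
      using K by (simp add: sum.inter_filter)
    have "(\<Sum>k\<in>K. if hd k = u then \<bar>s k\<bar> else 0) - (\<Sum>k\<in>K. if tl k = u then \<bar>s k\<bar> else 0)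
      = (\<Sum>k\<in>K. if c k = u then s k else 0) - (\<Sum>k\<in>K. if l k = u then s k else 0)"
      unfolding sum_subtractf[symmetric] by (intro sum.cong) (auto simp: hd_def tl_def)
    then show ?thesis unfolding vertex_sum_def 1 2 using K by (simp add: sum.inter_filter)
  qed
  ultimately show ?thesis using \<phi> by blast
qed

text \<open>The inverse of the isomorphism carries the coordinates of the model over to
  \<open>V\<close>.\<close>

lemma snowflake_edges:
  assumes "snowflake V E"
  obtains p n v where "1 \<le> p" "\<forall>i<p. 3 \<le> n i" "inj_on v (glue ` stars_verts p n)"
    "V = v ` glue ` stars_verts p n"
    "E = (\<lambda>(i, j). {v (i, 0), v (glue (i, j))}) ` (SIGMA i:{..<p}. {1..n i})"
proof -
  obtain p n f where E2: "E \<subseteq> {e. e \<subseteq> V \<and> card e = 2}" and pn: "1 \<le> p" "\<forall>i<p. 3 \<le> n i"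
    and f: "bij_betw f V (glue ` stars_verts p n)"
    and iso: "\<forall>u\<in>V. \<forall>v\<in>V. {u, v} \<in> E \<longleftrightarrow> {f u, f v} \<in> (`) glue ` stars_edges p n"
    using assms unfolding snowflake_def graph_iso_def by blast
  define W where "W = glue ` stars_verts p n"
  define v where "v = inv_into V f"
  have fW: "bij_betw f V W" using f by (simp add: W_def)
  have vW: "bij_betw v W V" unfolding v_def by (rule bij_betw_inv_into[OF fW])
  have fv: "f (v w) = w" if "w \<in> W" for w
    using fW that by (simp add: v_def bij_betw_inv_into_right)
  have vf: "v (f u) = u" if "u \<in> V" for u
    using fW that by (simp add: v_def bij_betw_inv_into_left)
  have edges: "(`) glue ` stars_edges p n = (\<lambda>(i, j). {(i, 0), glue (i, j)}) ` (SIGMA i:{..<p}. {1..n i})"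
    (is "_ = ?E")
  proof -
    have "stars_edges p n = (\<lambda>(i, j). {(i, 0), (i, j)}) ` (SIGMA i:{..<p}. {1..n i})"
      unfolding stars_edges_def by (auto simp: image_iff) (metis)
    moreover have "glue (i, 0) = (i, 0)" for i by (simp add: glue_def)
    ultimately show ?thesis by (simp add: image_image case_prod_unfold)
  qed
  have inW: "(i, 0) \<in> W" "glue (i, j) \<in> W" if "i < p" "j \<in> {1..n i}" for i j
  proof -
    have "glue (i, 0) = (i, 0)" by (simp add: glue_def)
    moreover have "(i, 0) \<in> stars_verts p n" "(i, j) \<in> stars_verts p n"
      using that by (auto simp: stars_verts_def)
    ultimately show "(i, 0) \<in> W" "glue (i, j) \<in> W" unfolding W_def by (metis imageI)+
  qed
  have "E = (\<lambda>(i, j). {v (i, 0), v (glue (i, j))}) ` (SIGMA i:{..<p}. {1..n i})"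
  proof (intro equalityI subsetI)
    fix e assume e: "e \<in> E"
    then obtain x y where xy: "e = {x, y}" "x \<in> V" "y \<in> V" using E2 by (auto simp: card_2_iff)
    then have "{f x, f y} \<in> ?E" using iso e edges by auto
    then obtain i j where ij: "i < p" "j \<in> {1..n i}" "{f x, f y} = {(i, 0), glue (i, j)}" by auto
    have "e = v ` {f x, f y}" using xy vf by simp
    then have "e = {v (i, 0), v (glue (i, j))}" unfolding ij(3) by simp
    then show "e \<in> (\<lambda>(i, j). {v (i, 0), v (glue (i, j))}) ` (SIGMA i:{..<p}. {1..n i})"
      using ij by (intro image_eqI[of _ _ "(i, j)"]) auto
  next
    fix e assume "e \<in> (\<lambda>(i, j). {v (i, 0), v (glue (i, j))}) ` (SIGMA i:{..<p}. {1..n i})"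
    then obtain i j where ij: "i < p" "j \<in> {1..n i}" "e = {v (i, 0), v (glue (i, j))}" by auto
    have "{f (v (i, 0)), f (v (glue (i, j)))} \<in> ?E"
      unfolding fv[OF inW(1)[OF ij(1,2)]] fv[OF inW(2)[OF ij(1,2)]]
      by (rule image_eqI[of _ _ "(i, j)"]) (use ij in auto)
    moreover have "v (i, 0) \<in> V" "v (glue (i, j)) \<in> V"
      using bij_betwE[OF vW] inW[OF ij(1,2)] by auto
    ultimately show "e \<in> E" using iso edges ij(3) by auto
  qed
  moreover have "inj_on v W" "V = v ` W" using vW by (auto simp: bij_betw_def)
  ultimately show ?thesis using that pn unfolding W_def by blast
qed

section \<open>Incidences and degrees of a snowflake in coordinates (star, leaf)\<close>

locale snowflake_coordinates =
  fixes p :: nat and n :: "nat \<Rightarrow> nat" and v :: "nat \<times> nat \<Rightarrow> 'a" and V :: "'a set" and E :: "'a set set"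
  assumes p: "1 \<le> p" and n: "i < p \<Longrightarrow> 3 \<le> n i" and inj_v: "inj_on v (glue ` stars_verts p n)"
    and V: "V = v ` glue ` stars_verts p n"
    and E: "E = (\<lambda>(i, j). {v (i, 0), v (glue (i, j))}) ` (SIGMA i:{..<p}. {1..n i})"
begin

definition K :: "(nat \<times> nat) set" where
  "K = (SIGMA i:{..<p}. {1..n i})"

definition hub :: "nat \<times> nat \<Rightarrow> 'a" where
  "hub k = v (fst k, 0)"

definition tip :: "nat \<times> nat \<Rightarrow> 'a" where
  "tip k = v (glue k)"

lemma finite_K: "finite K"
  by (simp add: K_def)

lemma E_eq: "E = (\<lambda>k. {hub k, tip k}) ` K"
  by (simp add: E K_def hub_def tip_def case_prod_unfold)

lemma hub_eq_iff: "k \<in> K \<Longrightarrow> w \<in> glue ` stars_verts p n \<Longrightarrow> hub k = v w \<longleftrightarrow> w = (fst k, 0)"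
proof -
  assume k: "k \<in> K" and w: "w \<in> glue ` stars_verts p n"
  have "glue (fst k, 0) = (fst k, 0)" by (simp add: glue_def)
  moreover have "(fst k, 0) \<in> stars_verts p n" using k by (auto simp: K_def stars_verts_def)
  ultimately have "(fst k, 0) \<in> glue ` stars_verts p n" by (metis imageI)
  from inj_onD[OF inj_v _ this w] show ?thesis by (auto simp: hub_def)
qed

lemma tip_eq_iff: "k \<in> K \<Longrightarrow> w \<in> glue ` stars_verts p n \<Longrightarrow> tip k = v w \<longleftrightarrow> w = glue k"
proof -
  assume k: "k \<in> K" and w: "w \<in> glue ` stars_verts p n"
  have "glue k \<in> glue ` stars_verts p n" using k by (auto simp: K_def stars_verts_def)
  from inj_onD[OF inj_v _ this w] show ?thesis by (auto simp: tip_def)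
qed

lemma glue_in: "k \<in> K \<Longrightarrow> glue k \<in> glue ` stars_verts p n"
  by (auto simp: K_def stars_verts_def)

lemma center_in: "i < p \<Longrightarrow> (i, 0) \<in> glue ` stars_verts p n"
proof -
  assume "i < p"
  then have "(i, 0) \<in> stars_verts p n" by (simp add: stars_verts_def)
  moreover have "glue (i, 0) = (i, 0)" by (simp add: glue_def)
  ultimately show ?thesis by (metis imageI)
qed

lemma snd_glue: "k \<in> K \<Longrightarrow> snd (glue k) \<noteq> 0"
  by (auto simp: K_def glue_def)

lemma hub_neq_tip: "k \<in> K \<Longrightarrow> k' \<in> K \<Longrightarrow> hub k \<noteq> tip k'"
  using hub_eq_iff[OF _ glue_in] snd_glue by (fastforce simp: tip_def)

lemma inj_edge: "inj_on (\<lambda>k. {hub k, tip k}) K"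
proof (rule inj_onI)
  fix k k' assume k: "k \<in> K" "k' \<in> K" and eq: "{hub k, tip k} = {hub k', tip k'}"
  then have h: "hub k = hub k'" and t: "tip k = tip k'"
    using hub_neq_tip by (auto simp: doubleton_eq_iff)
  have i: "fst k = fst k'"
    using h hub_eq_iff[OF k(1) center_in[of "fst k'"]] k(2) by (auto simp: hub_def K_def)
  have "glue k = glue k'" using t tip_eq_iff[OF k(1) glue_in[OF k(2)]] by (simp add: tip_def)
  then show "k = k'" using i by (auto simp: glue_def prod_eq_iff split: if_splits)
qed

lemma sum_K: "sum g K = (\<Sum>i<p. \<Sum>j\<in>{1..n i}. g (i, j))"
  using sum.Sigma[of "{..<p}" "\<lambda>i. {1..n i}" "\<lambda>i j. g (i, j)"] by (simp add: case_prod_unfold K_def)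

lemma sum_star: "sum g ({i} \<times> {1..n i}) = (\<Sum>j\<in>{1..n i}. g (i, j))"
  using sum.Sigma[of "{i}" "\<lambda>_. {1..n i}" "\<lambda>i j. g (i, j)"] by (simp add: case_prod_unfold)

lemma card_E: "card E = sum n {..<p}"
proof -
  have "card E = card K" unfolding E_eq by (rule card_image[OF inj_edge])
  then show ?thesis by (simp add: K_def)
qed

lemma finite_E: "finite E"
  unfolding E_eq using finite_K by simp

lemma card_edge: "\<forall>e\<in>E. card e = 2"
  using hub_neq_tip by (auto simp: E_eq)

lemma incident:
  assumes "w \<in> glue ` stars_verts p n"
  shows "{e\<in>E. v w \<in> e} = (\<lambda>k. {hub k, tip k}) ` {k\<in>K. w = (fst k, 0) \<or> w = glue k}"
proof -
  have "{k\<in>K. v w = hub k \<or> v w = tip k} = {k\<in>K. w = (fst k, 0) \<or> w = glue k}"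
    using hub_eq_iff[OF _ assms] tip_eq_iff[OF _ assms] by (intro Collect_cong) metis
  moreover have "{e\<in>E. v w \<in> e} = (\<lambda>k. {hub k, tip k}) ` {k\<in>K. v w = hub k \<or> v w = tip k}"
    unfolding E_eq by auto
  ultimately show ?thesis by simp
qed

lemma incident_center:
  assumes "i < p"
  shows "{e\<in>E. v (i, 0) \<in> e} = (\<lambda>k. {hub k, tip k}) ` ({i} \<times> {1..n i})"
proof -
  have "(i, 0) \<noteq> glue k" if "k \<in> K" for k using snd_glue[OF that] by (metis snd_conv)
  then have "{k\<in>K. (i, 0) = (fst k, 0) \<or> (i, 0) = glue k} = {k\<in>K. i = fst k}" by auto
  also have "\<dots> = {i} \<times> {1..n i}" using assms by (auto simp: K_def)
  finally have "{k\<in>K. (i, 0) = (fst k, 0) \<or> (i, 0) = glue k} = {i} \<times> {1..n i}" .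
  then show ?thesis using incident[OF center_in[OF assms]] by simp
qed

lemma star_subset: "i < p \<Longrightarrow> {i} \<times> {1..n i} \<subseteq> K"
  by (auto simp: K_def)

lemma degree_center:
  assumes "i < p"
  shows "degree E (v (i, 0)) = n i"
  unfolding degree_def incident_center[OF assms]
  using card_image[OF inj_on_subset[OF inj_edge star_subset[OF assms]]] by simp

lemma conservative_mod_4:
  assumes "conservative V E"
  shows "card E mod 4 \<in> {0, 3}"
proof -
  obtain A \<phi> where A: "orientation E A" and \<phi>: "bij_betw \<phi> E {1..card E}"
    and bal: "\<forall>u\<in>V. 3 \<le> degree E u \<longrightarrow> vertex_sum A \<phi> u = 0"
    using assms unfolding conservative_def conservative_labeling_def balanced_labeling_def by blast
  have star: "even (\<Sum>k\<in>{i} \<times> {1..n i}. \<phi> {hub k, tip k})" if i: "i < p" for i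
  proof -
    have "v (i, 0) \<in> V" using center_in[OF i] V by blast
    then have "vertex_sum A \<phi> (v (i, 0)) = 0" using bal degree_center[OF i] n[OF i] by simp
    then have "even (\<Sum>e\<in>{e\<in>E. v (i, 0) \<in> e}. \<phi> e)"
      using even_sum_incident[OF A finite_E card_edge] by blast
    then show ?thesis unfolding incident_center[OF i]
      by (subst (asm) sum.reindex[OF inj_on_subset[OF inj_edge star_subset[OF i]]]) simp
  qed
  have "\<Sum>{1..card E} = (\<Sum>e\<in>E. \<phi> e)" using sum.reindex_bij_betw[OF \<phi>, of "\<lambda>x. x"] by simp
  also have "\<dots> = (\<Sum>k\<in>K. \<phi> {hub k, tip k})"
    using sum.reindex[OF inj_edge, of \<phi>] by (simp add: E_eq)
  also have "\<dots> = (\<Sum>i<p. \<Sum>k\<in>{i} \<times> {1..n i}. \<phi> {hub k, tip k})"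
    by (simp only: sum_K sum_star)
  finally have "even (\<Sum>{1..card E})" using star by (auto intro: dvd_sum)
  moreover have "int (\<Sum>{1..m}) = \<Sum>{1..int m}" for m
  proof (induction m)
    case (Suc m)
    have "{1..int (Suc m)} = insert (int (Suc m)) {1..int m}" by auto
    then show ?case using Suc by simp
  qed simp
  ultimately have "even (\<Sum>{1..int (card E)})" by (metis even_of_nat)
  then have "int (card E) mod 4 \<in> {0, 3}" using even_sum_iff by simp
  then have "int (card E mod 4) \<in> {0, 3}" by (simp add: of_nat_mod)
  then show ?thesis by auto
qed

lemma balanced_labeling_exists:
  assumes L: "int ` L = labels (card E)" "finite L" "card L = card E"
  shows "\<exists>A \<phi>. balanced_labeling V E L A \<phi>"
proof -
  obtain f where f: "star_system {..<p} n f" "3 \<le> p \<longrightarrow> (\<Sum>i<p. hd (f i)) = 0"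
    using balanced_star_lists[of p n] p n by blast
  have len: "length (f i) = n i" and zero: "sum_list (f i) = 0" if "i < p" for i
    using f(1) that by (auto simp: star_system_def)
  \<comment> \<open>Leaves are numbered from 1 and list positions from 0, so the edge of leaf 1,
    which is glued into the centre, carries the head of the list.\<close>
  define s where "s k = f (fst k) ! (snd k - 1)" for k :: "nat \<times> nat"
  have "L \<subseteq> (\<lambda>k. nat \<bar>s k\<bar>) ` K"
  proof
    fix x assume "x \<in> L"
    then have "int x \<in> labels (sum n {..<p})" using L(1) by (auto simp: card_E)
    then obtain i y where i: "i < p" "y \<in> set (f i)" "int x = \<bar>y\<bar>"
      using f(1) by (auto simp: star_system_def)
    then obtain j where j: "j < n i" "y = f i ! j" using len by (auto simp: in_set_conv_nth)
    then show "x \<in> (\<lambda>k. nat \<bar>s k\<bar>) ` K"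
      using i by (intro image_eqI[of _ _ "(i, Suc j)"]) (auto simp: s_def K_def)
  qed
  moreover have "card K = card L" using L(3) card_E by (simp add: K_def)
  \<comment> \<open>There are as many edges as labels, so covering the labels already forces a
    bijection.\<close>
  ultimately have img: "(\<lambda>k. nat \<bar>s k\<bar>) ` K = L" and injs: "inj_on (\<lambda>k. nat \<bar>s k\<bar>) K"
    using finite_K card_image_le[OF finite_K, of "\<lambda>k. nat \<bar>s k\<bar>"] card_seteq[of "(\<lambda>k. nat \<bar>s k\<bar>) ` K" L]
    by (auto intro: eq_card_imp_inj_on)
  have "0 \<notin> L"
  proof
    assume "0 \<in> L"
    then have "0 \<in> labels (card E)" using L(1) by force
    then show False by (auto simp: labels_def gap_interval_def split: if_splits)
  qed
  then have s0: "\<forall>k\<in>K. s k \<noteq> 0" using img by force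
  have neq: "\<forall>k\<in>K. hub k \<noteq> tip k" using hub_neq_tip by blast
  obtain A \<phi> where A: "orientation E A" "\<forall>k\<in>K. \<phi> {hub k, tip k} = nat \<bar>s k\<bar>"
    "\<forall>u. vertex_sum A \<phi> u = (\<Sum>k\<in>{k\<in>K. hub k = u}. s k) - (\<Sum>k\<in>{k\<in>K. tip k = u}. s k)"
    using signed_edge_labeling[OF finite_K neq inj_edge E_eq s0] by blast
  have "\<phi> ` E = L" using A(2) img by (simp add: E_eq image_image)
  moreover have "inj_on \<phi> E"
    using A(2) injs unfolding E_eq by (auto simp: inj_on_def)
  ultimately have "bij_betw \<phi> E L" by (simp add: bij_betw_def)
  moreover have "vertex_sum A \<phi> u = 0" if u: "u \<in> V" "3 \<le> degree E u" for u
  proof -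
    obtain i j where ij: "i < p" "j \<le> n i" "u = v (glue (i, j))"
      using u(1) by (auto simp: V stars_verts_def)
    \<comment> \<open>These are the star centres, the centre of the snowflake, and the ordinary
      leaves, which have degree at most 1.\<close>
    consider "j = 0" | "j = 1" | "2 \<le> j" by linarith
    then show ?thesis
    proof cases
      case 1
      then have u: "u = v (i, 0)" using ij by (simp add: glue_def)
      have hubs: "{k\<in>K. hub k = u} = {i} \<times> {1..n i}"
        using hub_eq_iff[OF _ center_in[OF ij(1)]] ij(1) by (auto simp: u K_def)
      have "tip k \<noteq> u" if "k \<in> K" for k
        unfolding u tip_eq_iff[OF that center_in[OF ij(1)]] using snd_glue[OF that] by (metis snd_conv)
      then have tips: "{k\<in>K. tip k = u} = {}" by blast
      have star: "(\<Sum>k\<in>{i} \<times> {1..n i}. s k) = sum_list (f i)"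
      proof -
        have "(\<Sum>k\<in>{i} \<times> {1..n i}. s k) = (\<Sum>j\<in>{1..n i}. f i ! (j - 1))"
          unfolding sum_star by (simp add: s_def)
        also have "\<dots> = (\<Sum>j<n i. f i ! j)"
          by (rule sum.reindex_bij_witness[of _ Suc "\<lambda>j. j - 1"]) auto
        finally show ?thesis using len[OF ij(1)] by (simp add: sum_list_sum_nth atLeast0LessThan)
      qed
      show ?thesis unfolding A(3)[rule_format] hubs tips star using zero[OF ij(1)] by simp
    next
      case 2
      have z: "(0, 1) = glue (i, 1)" by (simp add: glue_def)
      have zW: "(0, 1) \<in> glue ` stars_verts p n"
        unfolding z using ij 2 by (auto simp: stars_verts_def)
      have u': "u = v (0, 1)" using ij 2 by (simp add: glue_def)
      have glue1: "(0, 1) = glue k \<longleftrightarrow> snd k = 1" for k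
        by (auto simp: glue_def)
      have one: "{k\<in>K. snd k = 1} = (\<lambda>i. (i, 1)) ` {..<p}"
        using n by (force simp: K_def)
      have "{e\<in>E. u \<in> e} = (\<lambda>k. {hub k, tip k}) ` {k\<in>K. snd k = 1}"
        unfolding u' incident[OF zW] glue1 by simp
      \<comment> \<open>The centre has degree at most \<open>p\<close>, so it is constrained only
        for \<open>3 \<le> p\<close>, where the heads sum to zero.\<close>
      then have "degree E u \<le> card {k\<in>K. snd k = 1}"
        unfolding degree_def using card_image_le[of "{k\<in>K. snd k = 1}"] finite_K by simp
      also have "\<dots> \<le> p"
        unfolding one using card_image_le[of "{..<p}" "\<lambda>i. (i, 1::nat)"] by simp
      finally have "degree E u \<le> p" .
      then have "3 \<le> p" using u by simp
      have hubs: "{k\<in>K. hub k = u} = {}"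
        using hub_eq_iff[OF _ zW] by (auto simp: u')
      have tips: "{k\<in>K. tip k = u} = (\<lambda>i. (i, 1)) ` {..<p}"
        unfolding one[symmetric] using tip_eq_iff[OF _ zW] glue1 by (auto simp: u')
      have center: "(\<Sum>k\<in>(\<lambda>i. (i, 1)) ` {..<p}. s k) = (\<Sum>i<p. hd (f i))"
      proof -
        have "f i ! 0 = hd (f i)" if "i < p" for i
          using len[OF that] n[OF that] by (intro hd_conv_nth[symmetric]) auto
        then show ?thesis by (subst sum.reindex) (auto simp: inj_on_def s_def)
      qed
      show ?thesis unfolding A(3)[rule_format] hubs tips center using f(2) \<open>3 \<le> p\<close> by simp
    next
      case 3
      then have u': "u = v (i, j)" using ij by (simp add: glue_def)
      have g: "glue (i, j) = (i, j)" using 3 by (simp add: glue_def)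
      have W: "(i, j) \<in> glue ` stars_verts p n"
        using ij by (intro image_eqI[of _ _ "(i, j)"]) (auto simp: g stars_verts_def)
      have "{k\<in>K. (i, j) = (fst k, 0) \<or> (i, j) = glue k} \<subseteq> {(i, j)}"
        using 3 by (auto simp: glue_def split: if_splits)
      then have "(\<lambda>k. {hub k, tip k}) ` {k\<in>K. (i, j) = (fst k, 0) \<or> (i, j) = glue k}
        \<subseteq> (\<lambda>k. {hub k, tip k}) ` {(i, j)}" by (rule image_mono)
      then have "{e\<in>E. u \<in> e} \<subseteq> {{hub (i, j), tip (i, j)}}"
        unfolding u' incident[OF W] by (simp only: image_insert image_empty)
      then have "degree E u \<le> 1"
        unfolding degree_def using card_mono[of "{{hub (i, j), tip (i, j)}}"] by simp
      then show ?thesis using u by simp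
    qed
  qed
  ultimately show ?thesis unfolding balanced_labeling_def using A(1) by blast
qed

end

theorem theorem37:
  fixes V :: "'a set" and E :: "'a set set" and M :: nat
  assumes "snowflake V E" and "M = card E"
  shows "(M mod 4 \<in> {0, 3} \<longrightarrow> conservative V E) \<and>
         (M mod 4 \<in> {1, 2} \<longrightarrow> near_conservative V E)"
proof -
  obtain p n v where "1 \<le> p" "\<forall>i<p. 3 \<le> n i" "inj_on v (glue ` stars_verts p n)"
    "V = v ` glue ` stars_verts p n"
    "E = (\<lambda>(i, j). {v (i, 0), v (glue (i, j))}) ` (SIGMA i:{..<p}. {1..n i})"
    by (rule snowflake_edges[OF assms(1)])
  then interpret snowflake_coordinates p n v V E by unfold_locales simp_all
  show ?thesis
  proof (intro conjI impI)
    assume M: "M mod 4 \<in> {0, 3}"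
    have "int ` {1..card E} = labels (card E)"
      using M assms(2) by (auto simp: labels_def gap_interval_def image_int_atLeastAtMost)
    then show "conservative V E"
      unfolding conservative_def conservative_labeling_def by (intro balanced_labeling_exists) auto
  next
    assume M: "M mod 4 \<in> {1, 2}"
    \<comment> \<open>This keeps the natural subtraction in \<open>card E - 1\<close> from
      truncating, so the label set has exactly \<open>card E\<close> elements.\<close>
    then have M1: "1 \<le> M" by (cases "M = 0") auto
    have "int ` ({1..card E - 1} \<union> {card E + 1}) = labels (card E)"
      using M M1 assms(2)
      by (auto simp: labels_def gap_interval_def image_Un image_int_atLeastAtMost of_nat_diff)
    then have "\<exists>A \<phi>. near_conservative_labeling V E A \<phi>"
      unfolding near_conservative_labeling_def using M1 assms(2)
      by (intro balanced_labeling_exists) auto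
    moreover have "\<not> conservative V E" using conservative_mod_4 M assms(2) by auto
    ultimately show "near_conservative V E" unfolding near_conservative_def by blast
  qed
qed

end
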